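(* Let $\mathbb{K}$ be a field of characteristic $5$. Then the elements $$A(x,y)=[x,[x,[x,y]]]+[y,[x,[x,y]]]+2[y,[y,[x,y]]],$$ $$B(x,y)=[y,[y,[y,x]]]+[x,[y,[y,x]]]+2[x,[x,[y,x]]]$$ of the free Lie algebra $\mathfrak{lie}_2$ over $\mathbb{K}$ on $x,y$ satisfy $$[x,A]+[y,B]=x^5+y^5-(x+y)^5,\qquad \tilde{\mathrm{tr}}(x\,\partial_xA+y\,\partial_yB)=\tfrac12\,\tilde{\mathrm{tr}}\bigl(x^{4}+y^{4}-(x+y)^{4}\bigr),$$ and the element $$\psi(x,y)=2[x,[x,[x,y]]]+2[y,[y,[x,y]]]+3[y,[x,[x,y]]],$$ which satisfies $\psi(-x-y,x)=A(x,y)$ and $\psi(-x-y,y)=B(x,y)$, belongs to the Grothendieck--Teichmüller Lie algebra $\mathfrak{grt}$ over $\mathbb{K}$.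
   Context: $\mathfrak{lie}_2$ is the (degree-completed) free Lie algebra over $\mathbb{K}$ on $x,y$, regarded as a subspace of the (degree-completed) free unital associative algebra $\mathrm{Assoc}_2$ on $x,y$ (its universal enveloping algebra). Every $a\in\mathrm{Assoc}_2$ is uniquely $a=a_0+a_1x+a_2y$ with $a_0\in\mathbb{K}$, $a_1,a_2\in\mathrm{Assoc}_2$; put $\partial_xa=a_1$, $\partial_ya=a_2$. The map $\tilde{\mathrm{tr}}$ is the natural projection to $\mathfrak{tr}_2=\mathrm{Assoc}_2^+/\langle ab-ba: a,b\in\mathrm{Assoc}_2\rangle$, where $\mathrm{Assoc}_2^+$ is the positive-degree part and one quotients by the subspace spanned by commutators. The Lie algebra $\mathfrak{t}_n$ is the quotient of the free Lie algebra over $\mathbb{K}$ with $n(n-1)/2$ generators $t^{i,j}=t^{j,i}$ ($1\le i\neq j\le n$) by the relations $[t^{i,j},t^{k,l}]=0$ if $i,j,k,l$ are all distinct, and $[t^{i,j}+t^{i,k},t^{j,k}]=0$ for all triples of distinct indices $i,j,k$. Put $t^{i,jk}=t^{i,j}+t^{i,k}$ and $t^{ij,k}=t^{i,k}+t^{j,k}$. $\mathfrak{grt}$ over $\mathbb{K}$ is the Lie algebra spanned by the elements $\psi\in\mathfrak{lie}_2$ satisfying: (i) $\psi(x,y)=-\psi(y,x)$; (ii) $\psi(x,y)+\psi(y,z)+\psi(z,x)=0$ where $z=-x-y$; (iii) $\psi(t^{1,2},t^{2,34})+\psi(t^{12,3},t^{3,4})=\psi(t^{2,3},t^{3,4})+\psi(t^{1,23},t^{23,4})+\psi(t^{1,2},t^{2,3})$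 in $\mathfrak{t}_4$ (degree-completed when $\psi$ is an infinite series), where $t^{2,34}=t^{2,3}+t^{2,4}$, $t^{12,3}=t^{1,3}+t^{2,3}$, $t^{1,23}=t^{1,2}+t^{1,3}$, $t^{23,4}=t^{2,4}+t^{3,4}$. Here $\psi(u,v)$ denotes the image of $\psi$ under the Lie algebra homomorphism sending $x\mapsto u$, $y\mapsto v$.
   Formalization: The two displayed identities are false with the printed sign (xxxxy has coefficient +1 on the left, −1 on the right); both right-hand sides are negated: (x+y)^5−x^5−y^5 and ½ tr((x+y)^4−x^4−y^4). A, B, ψ and all other claims are unchanged. *)

theory Defs
  imports Complex_Main
begin

section \<open>The completed free associative algebra\<close>

text \<open>
  A formal series in non-commuting variables \<open>'a\<close> with coefficients in \<open>'k\<close>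
  is a function on words.  This type is the degree-completed free unital associative
  algebra on \<open>'a\<close> when \<open>'a\<close> is finite, or when only finitely many letters are used.
\<close>

typedef ('a, 'k) ncs = "UNIV :: ('a list \<Rightarrow> 'k) set"
  morphisms nc_coeff Abs_ncs by simp

setup_lifting type_definition_ncs

lemma ncs_eqI: "(\<And>w. nc_coeff f w = nc_coeff g w) \<Longrightarrow> f = g"
  by transfer auto

instantiation ncs :: (type, comm_ring_1) ring_1
begin

lift_definition zero_ncs :: "('a, 'b) ncs" is "\<lambda>w. 0" .
lift_definition one_ncs :: "('a, 'b) ncs" is "\<lambda>w. if w = [] then 1 else 0" .
lift_definition plus_ncs :: "('a, 'b) ncs \<Rightarrow> ('a, 'b) ncs \<Rightarrow> ('a, 'b) ncs"
  is "\<lambda>f g w. f w + g w" .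
lift_definition minus_ncs :: "('a, 'b) ncs \<Rightarrow> ('a, 'b) ncs \<Rightarrow> ('a, 'b) ncs"
  is "\<lambda>f g w. f w - g w" .
lift_definition uminus_ncs :: "('a, 'b) ncs \<Rightarrow> ('a, 'b) ncs"
  is "\<lambda>f w. - f w" .
lift_definition times_ncs :: "('a, 'b) ncs \<Rightarrow> ('a, 'b) ncs \<Rightarrow> ('a, 'b) ncs"
  is "\<lambda>f g w. \<Sum>i\<le>length w. f (take i w) * g (drop i w)" .

instance
proof
  fix f g h :: "('a, 'b) ncs"
  show "f * g * h = f * (g * h)"
  proof (transfer, rule ext)
    fix f g h :: "'a list \<Rightarrow> 'b" and w :: "'a list"
    have reindex: "(\<Sum>j\<le>k. \<Sum>i\<le>j. F i (j - i) (n - j)) = (\<Sum>j\<le>k. \<Sum>i\<le>k - j. F j i (n - j - i))"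
      for F :: "nat \<Rightarrow> nat \<Rightarrow> nat \<Rightarrow> 'b" and k n
      by (induct k) (simp_all add: Suc_diff_le sum.distrib add.assoc)
    let ?F = "\<lambda>i j k. f (take i w) * g (take j (drop i w)) * h (drop (i + j) w)"
    have "(\<Sum>i\<le>length w. (\<Sum>j\<le>length (take i w). f (take j (take i w)) * g (drop j (take i w))) * h (drop i w))
        = (\<Sum>i\<le>length w. \<Sum>j\<le>i. ?F j (i - j) (length w - i))"
      by (intro sum.cong refl) (auto simp: sum_distrib_right min_def drop_take intro!: sum.cong)
    also have "\<dots> = (\<Sum>i\<le>length w. \<Sum>j\<le>length w - i. ?F i j (length w - i - j))"
      by (rule reindex)
    also have "\<dots> = (\<Sum>i\<le>length w. f (take i w) * (\<Sum>j\<le>length (drop i w). g (take j (drop i w)) * h (drop j (drop i w))))"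
      by (intro sum.cong refl) (auto simp: sum_distrib_left mult.assoc add.commute intro!: sum.cong)
    finally show "(\<Sum>i\<le>length w. (\<Sum>j\<le>length (take i w). f (take j (take i w)) * g (drop j (take i w))) * h (drop i w))
        = (\<Sum>i\<le>length w. f (take i w) * (\<Sum>j\<le>length (drop i w). g (take j (drop i w)) * h (drop j (drop i w))))" .
  qed
  show "1 * f = f"
  proof (transfer, rule ext)
    fix f :: "'a list \<Rightarrow> 'b" and w :: "'a list"
    have "(\<Sum>i\<le>length w. (if take i w = [] then 1 else 0) * f (drop i w))
        = (\<Sum>i\<le>length w. if i = 0 then f w else 0)"
      by (rule sum.cong) auto
    then show "(\<Sum>i\<le>length w. (if take i w = [] then 1 else 0) * f (drop i w)) = f w" by simp
  qed
  show "f * 1 = f"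
  proof (transfer, rule ext)
    fix f :: "'a list \<Rightarrow> 'b" and w :: "'a list"
    have "(\<Sum>i\<le>length w. f (take i w) * (if drop i w = [] then 1 else 0))
        = (\<Sum>i\<le>length w. if i = length w then f w else 0)"
      by (rule sum.cong) auto
    then show "(\<Sum>i\<le>length w. f (take i w) * (if drop i w = [] then 1 else 0)) = f w" by simp
  qed
  show "(f + g) * h = f * h + g * h"
    by transfer (simp add: distrib_right sum.distrib)
  show "f * (g + h) = f * g + f * h"
    by transfer (simp add: distrib_left sum.distrib)
  show "(0 :: ('a, 'b) ncs) \<noteq> 1"
    by transfer (metis zero_neq_one)
qed (transfer; simp add: fun_eq_iff algebra_simps)+

end

lift_definition nc_scale :: "'k \<Rightarrow> ('a, 'k::comm_ring_1) ncs \<Rightarrow> ('a, 'k) ncs"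
  is "\<lambda>c f w. c * f w" .

lift_definition nc_gen :: "'a \<Rightarrow> ('a, 'k::comm_ring_1) ncs"
  is "\<lambda>a w. if w = [a] then 1 else 0" .

lift_definition nc_part :: "nat \<Rightarrow> ('a, 'k::comm_ring_1) ncs \<Rightarrow> ('a, 'k) ncs"
  is "\<lambda>d f w. if length w = d then f w else 0" .

lemma nc_coeff_simps [simp]:
  fixes f g :: "('a, 'k::comm_ring_1) ncs"
  shows "nc_coeff 0 w = (0::'k)"
    and "nc_coeff 1 w = (if w = [] then 1 else (0::'k))"
    and "nc_coeff (f + g) w = nc_coeff f w + nc_coeff g w"
    and "nc_coeff (f - g) w = nc_coeff f w - nc_coeff g w"
    and "nc_coeff (- f) w = - nc_coeff f w"
    and "nc_coeff (nc_scale c f) w = c * nc_coeff f w"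
    and "nc_coeff (nc_gen a) w = (if w = [a] then 1 else (0::'k))"
    and "nc_coeff (nc_part d f) w = (if length w = d then nc_coeff f w else 0)"
  by (transfer; simp)+

lemma nc_coeff_mult:
  "nc_coeff (f * g) w = (\<Sum>i\<le>length w. nc_coeff f (take i w) * nc_coeff g (drop i w))"
  by transfer simp

interpretation ncs: vector_space "nc_scale :: 'k::field \<Rightarrow> ('a, 'k) ncs \<Rightarrow> ('a, 'k) ncs"
  by unfold_locales (rule ncs_eqI; simp add: algebra_simps)+

definition nc_bracket :: "('a, 'k::comm_ring_1) ncs \<Rightarrow> ('a, 'k) ncs \<Rightarrow> ('a, 'k) ncs"
    (\<open>\<lbrakk>_,/ _\<rbrakk>\<close>) where
  "\<lbrakk>f, g\<rbrakk> = f * g - g * f"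

text \<open>
  For a graded subspace \<open>S\<close> of the non-completed algebra this is its degree completion:
  the series all of whose homogeneous parts lie in \<open>S\<close>.
\<close>

definition nc_completion :: "('a, 'k::comm_ring_1) ncs set \<Rightarrow> ('a, 'k) ncs set" where
  "nc_completion S = {f. \<forall>d. nc_part d f \<in> S}"

text \<open>
  \<open>nc_coset S f\<close> is the class of \<open>f\<close> modulo a subspace \<open>S\<close>, and \<open>coset_scale S c\<close> is
  multiplication by the scalar \<open>c\<close> on the quotient.
\<close>

definition nc_coset :: "('a, 'k::comm_ring_1) ncs set \<Rightarrow> ('a, 'k) ncs \<Rightarrow> ('a, 'k) ncs set" where
  "nc_coset S f = {g. g - f \<in> S}"

definition coset_scale ::
    "('a, 'k::comm_ring_1) ncs set \<Rightarrow> 'k \<Rightarrow> ('a, 'k) ncs set \<Rightarrow> ('a, 'k) ncs set" where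
  "coset_scale S c F = (\<Union>f\<in>F. nc_coset S (nc_scale c f))"

lemma coset_scale_nc_coset:
  fixes f :: "('a, 'k::field) ncs"
  assumes "ncs.subspace S"
  shows "coset_scale S c (nc_coset S f) = nc_coset S (nc_scale c f)"
proof -
  have "g - nc_scale c f \<in> S" if "h - f \<in> S" "g - nc_scale c h \<in> S" for g h
  proof -
    have "g - nc_scale c f = (g - nc_scale c h) + nc_scale c (h - f)"
      by (simp add: ncs.scale_right_diff_distrib)
    moreover have "(g - nc_scale c h) + nc_scale c (h - f) \<in> S"
      using that assms by (intro ncs.subspace_add ncs.subspace_scale)
    ultimately show ?thesis by metis
  qed
  moreover have "f - f \<in> S" using assms by (simp add: ncs.subspace_0)
  ultimately show ?thesis unfolding coset_scale_def nc_coset_def by blast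
qed


section \<open>Free Lie algebras and Lie ideals\<close>

text \<open>
  Over a field the free Lie algebra on a set of letters is the Lie subalgebra generated by
  these letters in the free associative algebra, its universal enveloping algebra.
\<close>

inductive_set lie_generated :: "('a, 'k::comm_ring_1) ncs set \<Rightarrow> ('a, 'k) ncs set"
  for G :: "('a, 'k) ncs set" where
  gen: "g \<in> G \<Longrightarrow> g \<in> lie_generated G"
| zero: "0 \<in> lie_generated G"
| add: "f \<in> lie_generated G \<Longrightarrow> g \<in> lie_generated G \<Longrightarrow> f + g \<in> lie_generated G"
| scale: "f \<in> lie_generated G \<Longrightarrow> nc_scale c f \<in> lie_generated G"
| bracket: "f \<in> lie_generated G \<Longrightarrow> g \<in> lie_generated G \<Longrightarrow> \<lbrakk>f, g\<rbrakk> \<in> lie_generated G"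

inductive_set lie_ideal :: "('a, 'k::comm_ring_1) ncs set \<Rightarrow> ('a, 'k) ncs set \<Rightarrow> ('a, 'k) ncs set"
  for L R :: "('a, 'k) ncs set" where
  gen: "r \<in> R \<Longrightarrow> r \<in> lie_ideal L R"
| zero: "0 \<in> lie_ideal L R"
| add: "f \<in> lie_ideal L R \<Longrightarrow> g \<in> lie_ideal L R \<Longrightarrow> f + g \<in> lie_ideal L R"
| scale: "f \<in> lie_ideal L R \<Longrightarrow> nc_scale c f \<in> lie_ideal L R"
| bracket: "f \<in> L \<Longrightarrow> g \<in> lie_ideal L R \<Longrightarrow> \<lbrakk>f, g\<rbrakk> \<in> lie_ideal L R"

lemma subspace_lie_generated: "ncs.subspace (lie_generated G)"
  for G :: "('a, 'k::field) ncs set"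
  by (auto simp: ncs.subspace_def intro: lie_generated.intros)

lemma subspace_lie_ideal: "ncs.subspace (lie_ideal L R)"
  for R :: "('a, 'k::field) ncs set"
  by (auto simp: ncs.subspace_def intro: lie_ideal.intros)

lemma subspace_nc_completion:
  fixes S :: "('a, 'k::field) ncs set"
  assumes "ncs.subspace S"
  shows "ncs.subspace (nc_completion S)"
proof -
  have "nc_part d 0 = (0 :: ('a, 'k) ncs)" for d
    by (rule ncs_eqI) simp
  moreover have "nc_part d (f + g) = nc_part d f + nc_part d g" for d and f g :: "('a, 'k) ncs"
    by (rule ncs_eqI) simp
  moreover have "nc_part d (nc_scale c f) = nc_scale c (nc_part d f)" for d c and f :: "('a, 'k) ncs"
    by (rule ncs_eqI) simp
  ultimately show ?thesis
    using assms by (simp add: ncs.subspace_def nc_completion_def)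
qed


section \<open>Two generators\<close>

datatype letter = LX | LY

instance letter :: finite
proof
  have "(UNIV :: letter set) = {LX, LY}" by (auto intro: letter.exhaust)
  then show "finite (UNIV :: letter set)" by (metis finite.emptyI finite.insertI)
qed

abbreviation gen_x :: "(letter, 'k::comm_ring_1) ncs" where "gen_x \<equiv> nc_gen LX"
abbreviation gen_y :: "(letter, 'k::comm_ring_1) ncs" where "gen_y \<equiv> nc_gen LY"

definition lie2 :: "(letter, 'k::field) ncs set" where
  "lie2 = nc_completion (lie_generated {gen_x, gen_y})"

definition partial_x :: "(letter, 'k::field) ncs \<Rightarrow> (letter, 'k) ncs" where
  "partial_x a = (THE a1. \<exists>a0 a2. a = nc_scale a0 1 + a1 * gen_x + a2 * gen_y)"

definition partial_y :: "(letter, 'k::field) ncs \<Rightarrow> (letter, 'k) ncs" where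
  "partial_y a = (THE a2. \<exists>a0 a1. a = nc_scale a0 1 + a1 * gen_x + a2 * gen_y)"

lemma nc_coeff_mult_gen:
  "nc_coeff (f * nc_gen a) w = (if w \<noteq> [] \<and> last w = a then nc_coeff f (butlast w) else 0)"
proof (cases w rule: rev_cases)
  case (snoc v b)
  have drop_eq: "drop i w = [a] \<longleftrightarrow> i = length v \<and> b = a" if "i \<le> length w" for i
  proof
    assume d: "drop i w = [a]"
    have "length w - i = 1" using arg_cong[OF d, of length] by simp
    then have "i = length v" using snoc by simp
    then show "i = length v \<and> b = a" using d snoc by simp
  qed (simp add: snoc)
  have "nc_coeff (f * nc_gen a) w =
      (\<Sum>i\<le>length w. if i = length v then if b = a then nc_coeff f v else 0 else 0)"
    unfolding nc_coeff_mult
    by (intro sum.cong refl) (simp add: drop_eq, simp add: snoc)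
  then show ?thesis by (simp add: snoc)
qed (simp add: nc_coeff_mult)

lemma nc_decomposition_iff:
  "a = nc_scale a0 1 + a1 * gen_x + a2 * gen_y \<longleftrightarrow>
     a0 = nc_coeff a [] \<and> (\<forall>w. nc_coeff a1 w = nc_coeff a (w @ [LX]))
       \<and> (\<forall>w. nc_coeff a2 w = nc_coeff a (w @ [LY]))" (is "?L \<longleftrightarrow> ?R")
proof
  assume ?L
  then show ?R by (simp add: nc_coeff_mult_gen)
next
  assume R: ?R
  show ?L
  proof (rule ncs_eqI)
    fix w
    show "nc_coeff a w = nc_coeff (nc_scale a0 1 + a1 * gen_x + a2 * gen_y) w"
    proof (cases w rule: rev_cases)
      case (snoc v l)
      then show ?thesis using R by (cases l) (simp_all add: nc_coeff_mult_gen)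
    qed (simp add: R nc_coeff_mult_gen)
  qed
qed

lemma nc_decomposition:
  "\<exists>!(a0, a1, a2). a = nc_scale a0 1 + a1 * gen_x + a2 * gen_y"
proof (rule ex1I)
  let ?d = "\<lambda>l. Abs_ncs (\<lambda>w. nc_coeff a (w @ [l]))"
  show "case (nc_coeff a [], ?d LX, ?d LY) of
      (a0, a1, a2) \<Rightarrow> a = nc_scale a0 1 + a1 * gen_x + a2 * gen_y"
    by (simp add: nc_decomposition_iff Abs_ncs_inverse)
  fix t assume "case t of (a0, a1, a2) \<Rightarrow> a = nc_scale a0 1 + a1 * gen_x + a2 * gen_y"
  moreover obtain a0 a1 a2 where t: "t = (a0, a1, a2)" by (cases t)
  ultimately have *: "a = nc_scale a0 1 + a1 * gen_x + a2 * gen_y" by simp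
  have **: "a0 = nc_coeff a []" "\<And>w. nc_coeff a1 w = nc_coeff a (w @ [LX])"
      "\<And>w. nc_coeff a2 w = nc_coeff a (w @ [LY])"
    using * unfolding nc_decomposition_iff by blast+
  have "a1 = ?d LX" "a2 = ?d LY"
    by (rule ncs_eqI, simp add: ** Abs_ncs_inverse)+
  with **(1) show "t = (nc_coeff a [], ?d LX, ?d LY)" using t by simp
qed

lemma nc_coeff_partial_x: "nc_coeff (partial_x a) w = nc_coeff a (w @ [LX])"
proof -
  let ?d = "\<lambda>l. Abs_ncs (\<lambda>w. nc_coeff a (w @ [l]))"
  have "partial_x a = ?d LX"
    unfolding partial_x_def nc_decomposition_iff
  proof (rule the_equality, intro exI[of _ "nc_coeff a []"] exI[of _ "?d LY"])
    fix b assume "\<exists>a0 c. a0 = nc_coeff a [] \<and> (\<forall>w. nc_coeff b w = nc_coeff a (w @ [LX])) \<and> (\<forall>w. nc_coeff c w = nc_coeff a (w @ [LY]))"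
    then show "b = ?d LX" by (intro ncs_eqI) (auto simp: Abs_ncs_inverse)
  qed (simp add: Abs_ncs_inverse)
  then show ?thesis by (simp add: Abs_ncs_inverse)
qed

lemma nc_coeff_partial_y: "nc_coeff (partial_y a) w = nc_coeff a (w @ [LY])"
proof -
  let ?d = "\<lambda>l. Abs_ncs (\<lambda>w. nc_coeff a (w @ [l]))"
  have "partial_y a = ?d LY"
    unfolding partial_y_def nc_decomposition_iff
  proof (rule the_equality, intro exI[of _ "nc_coeff a []"] exI[of _ "?d LX"])
    fix b assume "\<exists>a0 c. a0 = nc_coeff a [] \<and> (\<forall>w. nc_coeff c w = nc_coeff a (w @ [LX])) \<and> (\<forall>w. nc_coeff b w = nc_coeff a (w @ [LY]))"
    then show "b = ?d LY" by (intro ncs_eqI) (auto simp: Abs_ncs_inverse)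
  qed (simp add: Abs_ncs_inverse)
  then show ?thesis by (simp add: Abs_ncs_inverse)
qed

text \<open>
  Commutators have no constant term, so the class of a series of positive degree modulo
  \<open>commutator_span\<close> is its class in the quotient of the positive-degree part.
\<close>

definition commutator_span :: "(letter, 'k::field) ncs set" where
  "commutator_span = ncs.span {a * b - b * a | a b. True}"

definition nc_tr :: "(letter, 'k::field) ncs \<Rightarrow> (letter, 'k) ncs set" where
  "nc_tr a = nc_coset commutator_span a"

definition tr_scale :: "'k \<Rightarrow> (letter, 'k::field) ncs set \<Rightarrow> (letter, 'k) ncs set" where
  "tr_scale = coset_scale commutator_span"


section \<open>Substitution\<close>

text \<open>
  \<open>nc_subst u v f\<close> is \<open>f(u, v)\<close>, for \<open>u\<close> and \<open>v\<close> without constant term: then a word of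
  length greater than \<open>length w\<close> in \<open>u, v\<close> does not contribute to the coefficient of \<open>w\<close>, so
  that the sum below is the full one.  On the free Lie algebra this is the (continuous) Lie
  algebra homomorphism given by \<open>x \<mapsto> u\<close>, \<open>y \<mapsto> v\<close>.
\<close>

fun letter_value :: "'b \<Rightarrow> 'b \<Rightarrow> letter \<Rightarrow> 'b" where
  "letter_value u v LX = u"
| "letter_value u v LY = v"

definition word_value :: "'b::monoid_mult \<Rightarrow> 'b \<Rightarrow> letter list \<Rightarrow> 'b" where
  "word_value u v p = prod_list (map (letter_value u v) p)"

definition nc_subst ::
    "('a, 'k::comm_ring_1) ncs \<Rightarrow> ('a, 'k) ncs \<Rightarrow> (letter, 'k) ncs \<Rightarrow> ('a, 'k) ncs" where
  "nc_subst u v f =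
     Abs_ncs (\<lambda>w. \<Sum>p | length p \<le> length w. nc_coeff f p * nc_coeff (word_value u v p) w)"

lemma nc_coeff_subst:
  "nc_coeff (nc_subst u v f) w =
     (\<Sum>p | length p \<le> length w. nc_coeff f p * nc_coeff (word_value u v p) w)"
  by (simp add: nc_subst_def Abs_ncs_inverse)

lemma nc_subst_add: "nc_subst u v (f + g) = nc_subst u v f + nc_subst u v g"
  by (rule ncs_eqI) (simp add: nc_coeff_subst distrib_right sum.distrib)

lemma nc_subst_scale: "nc_subst u v (nc_scale c f) = nc_scale c (nc_subst u v f)"
  by (rule ncs_eqI) (simp add: nc_coeff_subst sum_distrib_left mult.assoc)

lemma finite_words_le: "finite {p :: letter list. length p \<le> n}"
  using finite_lists_length_le[of "UNIV :: letter set" n] by simp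

lemma word_value_coeff_eq_0:
  assumes "nc_coeff u [] = 0" "nc_coeff v [] = 0" "length w < length p"
  shows "nc_coeff (word_value u v p) w = 0"
  using assms(3)
proof (induction p arbitrary: w)
  case (Cons l p)
  have "nc_coeff (letter_value u v l) (take i w) * nc_coeff (word_value u v p) (drop i w) = 0"
    if "i \<le> length w" for i
  proof (cases "i = 0")
    case True
    then show ?thesis using assms by (cases l) auto
  next
    case False
    then have "length (drop i w) < length p" using Cons.prems that by simp
    then show ?thesis using Cons.IH by simp
  qed
  then show ?case by (simp add: word_value_def nc_coeff_mult)
qed simp

lemma nc_coeff_subst_le:
  assumes "nc_coeff u [] = 0" "nc_coeff v [] = 0" "length w \<le> n"
  shows "nc_coeff (nc_subst u v f) w =
    (\<Sum>p | length p \<le> n. nc_coeff f p * nc_coeff (word_value u v p) w)"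
  unfolding nc_coeff_subst
  by (rule sum.mono_neutral_left)
    (use assms finite_words_le in \<open>auto simp: word_value_coeff_eq_0\<close>)

lemma nc_subst_gen:
  assumes "nc_coeff u [] = 0" "nc_coeff v [] = 0"
  shows "nc_subst u v (nc_gen l) = letter_value u v l"
proof (rule ncs_eqI)
  fix w
  have "nc_coeff (nc_subst u v (nc_gen l)) w =
      (\<Sum>p | length p \<le> Suc (length w). if p = [l] then nc_coeff (letter_value u v l) w else 0)"
    unfolding nc_coeff_subst_le[OF assms le_SucI[OF order_refl]]
    by (intro sum.cong) (auto simp: word_value_def)
  then show "nc_coeff (nc_subst u v (nc_gen l)) w = nc_coeff (letter_value u v l) w"
    by (simp add: finite_words_le)
qed

lemma nc_subst_mult:
  fixes u v :: "('a, 'k::comm_ring_1) ncs"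
  assumes "nc_coeff u [] = 0" "nc_coeff v [] = 0"
  shows "nc_subst u v (f * g) = nc_subst u v f * nc_subst u v g"
proof (rule ncs_eqI)
  fix w :: "'a list"
  let ?n = "length w"
  let ?W = "{p :: letter list. length p \<le> ?n}"
  let ?V = "\<lambda>p. nc_coeff (word_value u v p)"
  let ?h = "\<lambda>q r. nc_coeff f q * nc_coeff g r * ?V (q @ r) w"
  let ?S = "Sigma ?W (\<lambda>p. {..length p})"
  let ?T = "{(q, r). length q + length r \<le> ?n} :: (letter list \<times> letter list) set"
  have V_append: "?V (q @ r) w = (\<Sum>i\<le>?n. ?V q (take i w) * ?V r (drop i w))" for q r
    by (simp add: word_value_def nc_coeff_mult)
  have V_long: "?V (q @ r) w = 0" if "\<not> length q + length r \<le> ?n" for q r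
    using that by (intro word_value_coeff_eq_0 assms) simp
  have fT: "finite (?W \<times> ?W)" by (simp add: finite_words_le)
  have "nc_coeff (nc_subst u v (f * g)) w =
      (\<Sum>p\<in>?W. \<Sum>i\<le>length p. ?h (take i p) (drop i p))"
    by (simp add: nc_coeff_subst nc_coeff_mult sum_distrib_right)
  also have "\<dots> = (\<Sum>(p, i)\<in>?S. ?h (take i p) (drop i p))"
    by (rule sum.Sigma) (auto simp: finite_words_le)
  also have "\<dots> = (\<Sum>(q, r)\<in>?T. ?h q r)"
    by (rule sum.reindex_bij_witness[of _ "\<lambda>(q, r). (q @ r, length q)" "\<lambda>(p, i). (take i p, drop i p)"])
      auto
  also have "\<dots> = (\<Sum>(q, r)\<in>?W \<times> ?W. ?h q r)"
    by (rule sum.mono_neutral_left[OF fT]) (auto, rule ccontr, simp add: V_long)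
  also have "\<dots> = (\<Sum>q\<in>?W. \<Sum>r\<in>?W. \<Sum>i\<le>?n.
      (nc_coeff f q * ?V q (take i w)) * (nc_coeff g r * ?V r (drop i w)))"
    by (simp add: sum.cartesian_product[symmetric] V_append sum_distrib_left mult_ac)
  also have "\<dots> = (\<Sum>q\<in>?W. \<Sum>i\<le>?n. \<Sum>r\<in>?W.
      (nc_coeff f q * ?V q (take i w)) * (nc_coeff g r * ?V r (drop i w)))"
    by (intro sum.cong refl sum.swap)
  also have "\<dots> = (\<Sum>i\<le>?n. \<Sum>q\<in>?W. \<Sum>r\<in>?W.
      (nc_coeff f q * ?V q (take i w)) * (nc_coeff g r * ?V r (drop i w)))"
    by (rule sum.swap)
  also have "\<dots> = (\<Sum>i\<le>?n. (\<Sum>q\<in>?W. nc_coeff f q * ?V q (take i w)) *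
      (\<Sum>r\<in>?W. nc_coeff g r * ?V r (drop i w)))"
    by (simp add: sum_product)
  also have "\<dots> = nc_coeff (nc_subst u v f * nc_subst u v g) w"
    by (simp add: nc_coeff_mult nc_coeff_subst_le[OF assms, of _ ?n])
  finally show "nc_coeff (nc_subst u v (f * g)) w = nc_coeff (nc_subst u v f * nc_subst u v g) w" .
qed


section \<open>The Lie algebras of infinitesimal braids\<close>

text \<open>
  The generator \<open>t i j\<close> is the letter \<open>{i, j}\<close>, which makes it symmetric in \<open>i\<close> and \<open>j\<close>.
\<close>

definition tgen :: "nat \<Rightarrow> nat \<Rightarrow> (nat set, 'k::comm_ring_1) ncs" where
  "tgen i j = nc_gen {i, j}"

definition t_free :: "nat \<Rightarrow> (nat set, 'k::comm_ring_1) ncs set" where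
  "t_free n = lie_generated {tgen i j | i j. i \<in> {1..n} \<and> j \<in> {1..n} \<and> i \<noteq> j}"

definition t_relators :: "nat \<Rightarrow> (nat set, 'k::comm_ring_1) ncs set" where
  "t_relators n =
     {\<lbrakk>tgen i j, tgen k l\<rbrakk> | i j k l. {i, j, k, l} \<subseteq> {1..n} \<and> distinct [i, j, k, l]} \<union>
     {\<lbrakk>tgen i j + tgen i k, tgen j k\<rbrakk> | i j k. {i, j, k} \<subseteq> {1..n} \<and> distinct [i, j, k]}"

text \<open>
  \<open>t_class n f\<close> is the class in the completed Lie algebra \<open>t_n\<close> of an element \<open>f\<close> of the
  completed free Lie algebra on the generators.
\<close>

definition t_class :: "nat \<Rightarrow> (nat set, 'k::comm_ring_1) ncs \<Rightarrow> (nat set, 'k) ncs set" where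
  "t_class n f = nc_coset (nc_completion (lie_ideal (t_free n) (t_relators n))) f"


section \<open>The Grothendieck--Teichmueller Lie algebra\<close>

text \<open>
  The values of \<open>\<psi>\<close> in \<open>t_4\<close> are the classes of its values in the completed free Lie algebra,
  and the class map is linear.
\<close>

definition pentagon :: "(letter, 'k::field) ncs \<Rightarrow> bool" where
  "pentagon \<psi> \<longleftrightarrow>
     t_class 4 (nc_subst (tgen 1 2) (tgen 2 3 + tgen 2 4) \<psi>
              + nc_subst (tgen 1 3 + tgen 2 3) (tgen 3 4) \<psi>)
   = t_class 4 (nc_subst (tgen 2 3) (tgen 3 4) \<psi>
              + nc_subst (tgen 1 2 + tgen 1 3) (tgen 2 4 + tgen 3 4) \<psi>
              + nc_subst (tgen 1 2) (tgen 2 3) \<psi>)"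

definition grt :: "(letter, 'k::field) ncs set" where
  "grt = {\<psi> \<in> lie2.
     nc_subst gen_x gen_y \<psi> = - nc_subst gen_y gen_x \<psi> \<and>
     nc_subst gen_x gen_y \<psi> + nc_subst gen_y (- gen_x - gen_y) \<psi>
       + nc_subst (- gen_x - gen_y) gen_x \<psi> = 0 \<and>
     pentagon \<psi>}"

text \<open>The conditions are linear, so \<open>grt\<close> is the space spanned by their solutions.\<close>

lemma nc_coset_eq_iff:
  fixes S :: "('a, 'k::field) ncs set"
  assumes "ncs.subspace S"
  shows "nc_coset S f = nc_coset S g \<longleftrightarrow> f - g \<in> S"
proof
  assume "nc_coset S f = nc_coset S g"
  moreover have "f \<in> nc_coset S f" using assms by (simp add: nc_coset_def ncs.subspace_0)
  ultimately show "f - g \<in> S" by (simp add: nc_coset_def)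
next
  assume fg: "f - g \<in> S"
  have "h - f \<in> S \<longleftrightarrow> h - g \<in> S" for h
    using ncs.subspace_add[OF assms _ fg, of "h - f"] ncs.subspace_diff[OF assms _ fg, of "h - g"]
    by auto
  then show "nc_coset S f = nc_coset S g" by (simp add: nc_coset_def)
qed

lemma subspace_grt: "ncs.subspace (grt :: (letter, 'k::field) ncs set)"
proof -
  let ?I = "nc_completion (lie_ideal (t_free 4) (t_relators 4)) :: (nat set, 'k) ncs set"
  let ?P = "\<lambda>\<psi> :: (letter, 'k) ncs.
     (nc_subst (tgen 1 2) (tgen 2 3 + tgen 2 4) \<psi> + nc_subst (tgen 1 3 + tgen 2 3) (tgen 3 4) \<psi>)
   - (nc_subst (tgen 2 3) (tgen 3 4) \<psi> + nc_subst (tgen 1 2 + tgen 1 3) (tgen 2 4 + tgen 3 4) \<psi>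
      + nc_subst (tgen 1 2) (tgen 2 3) \<psi>)"
  have I: "ncs.subspace ?I" and lie2: "ncs.subspace (lie2 :: (letter, 'k) ncs set)"
    unfolding lie2_def
    by (intro subspace_nc_completion subspace_lie_ideal subspace_lie_generated)+
  have pent: "pentagon \<psi> \<longleftrightarrow> ?P \<psi> \<in> ?I" for \<psi>
    unfolding pentagon_def t_class_def by (rule nc_coset_eq_iff[OF I])
  have subst_0: "nc_subst u v 0 = 0" for u v :: "('b, 'k) ncs"
    by (rule ncs_eqI) (simp add: nc_coeff_subst)
  have P_add: "?P (f + g) = ?P f + ?P g" for f g
    by (simp add: nc_subst_add algebra_simps)
  have P_scale: "?P (nc_scale c f) = nc_scale c (?P f)" for c f
    by (simp add: nc_subst_scale ncs.scale_right_diff_distrib ncs.scale_right_distrib)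
  show ?thesis
    unfolding ncs.subspace_def
  proof (intro conjI ballI allI)
    show "0 \<in> (grt :: (letter, 'k) ncs set)"
      using I lie2 by (simp add: grt_def pent subst_0 ncs.subspace_0)
  next
    fix f g :: "(letter, 'k) ncs" assume "f \<in> grt" "g \<in> grt"
    then have f: "f \<in> lie2" "?P f \<in> ?I"
        "nc_subst gen_x gen_y f = - nc_subst gen_y gen_x f"
        "nc_subst gen_x gen_y f + nc_subst gen_y (- gen_x - gen_y) f
          + nc_subst (- gen_x - gen_y) gen_x f = 0"
      and g: "g \<in> lie2" "?P g \<in> ?I"
        "nc_subst gen_x gen_y g = - nc_subst gen_y gen_x g"
        "nc_subst gen_x gen_y g + nc_subst gen_y (- gen_x - gen_y) g
          + nc_subst (- gen_x - gen_y) gen_x g = 0"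
      by (auto simp: grt_def pent)
    have "?P (f + g) \<in> ?I"
      unfolding P_add by (rule ncs.subspace_add[OF I f(2) g(2)])
    moreover have "f + g \<in> lie2" by (rule ncs.subspace_add[OF lie2 f(1) g(1)])
    moreover have "nc_subst gen_x gen_y (f + g) = - nc_subst gen_y gen_x (f + g)"
      using f(3) g(3) by (simp add: nc_subst_add)
    moreover have "nc_subst gen_x gen_y (f + g) + nc_subst gen_y (- gen_x - gen_y) (f + g)
          + nc_subst (- gen_x - gen_y) gen_x (f + g) =
        (nc_subst gen_x gen_y f + nc_subst gen_y (- gen_x - gen_y) f
          + nc_subst (- gen_x - gen_y) gen_x f) +
        (nc_subst gen_x gen_y g + nc_subst gen_y (- gen_x - gen_y) g
          + nc_subst (- gen_x - gen_y) gen_x g)"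
      by (simp add: nc_subst_add algebra_simps)
    ultimately show "f + g \<in> grt"
      unfolding grt_def pent mem_Collect_eq using f(4) g(4) by simp
  next
    fix c :: 'k and f :: "(letter, 'k) ncs" assume "f \<in> grt"
    then have f: "f \<in> lie2" "?P f \<in> ?I"
        "nc_subst gen_x gen_y f = - nc_subst gen_y gen_x f"
        "nc_subst gen_x gen_y f + nc_subst gen_y (- gen_x - gen_y) f
          + nc_subst (- gen_x - gen_y) gen_x f = 0"
      by (auto simp: grt_def pent)
    have "?P (nc_scale c f) \<in> ?I"
      unfolding P_scale by (rule ncs.subspace_scale[OF I f(2)])
    moreover have "nc_scale c f \<in> lie2" by (rule ncs.subspace_scale[OF lie2 f(1)])
    moreover have "nc_subst gen_x gen_y (nc_scale c f) = - nc_subst gen_y gen_x (nc_scale c f)"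
      using f(3) by (simp add: nc_subst_scale)
    moreover have "nc_subst gen_x gen_y (nc_scale c f)
          + nc_subst gen_y (- gen_x - gen_y) (nc_scale c f)
          + nc_subst (- gen_x - gen_y) gen_x (nc_scale c f) =
        nc_scale c (nc_subst gen_x gen_y f + nc_subst gen_y (- gen_x - gen_y) f
          + nc_subst (- gen_x - gen_y) gen_x f)"
      by (simp add: nc_subst_scale ncs.scale_right_distrib)
    ultimately show "nc_scale c f \<in> grt"
      unfolding grt_def pent mem_Collect_eq using f(4) by simp
  qed
qed


section \<open>Signs\<close>

text \<open>
  For the elements \<open>A\<close> and \<open>B\<close> below, the source states the identities
  \<open>[x, A] + [y, B] = x^5 + y^5 - (x + y)^5\<close> and
  \<open>tr (x \<partial>\<^sub>x A + y \<partial>\<^sub>y B) = 1/2 tr (x^4 + y^4 - (x + y)^4)\<close>.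
  Both fail; they hold with the right-hand sides negated (equivalently, as printed but
  with \<open>A\<close> and \<open>B\<close> negated).
  The coefficients of \<open>xxxxy\<close> and of the cyclic word \<open>xxxy\<close> show this.
\<close>

lemma nc_coeff_two_mult: "nc_coeff (2 * f) w = 2 * nc_coeff f w"
  by (simp only: mult_2 nc_coeff_simps)

lemma nc_coeff_gen_mult: "nc_coeff (nc_gen a * f) w = (if w \<noteq> [] \<and> hd w = a then nc_coeff f (tl w) else 0)"
proof (cases w)
  case (Cons b v)
  have "nc_coeff (nc_gen a * f) w = (\<Sum>i\<le>length w. if i = 1 then if b = a then nc_coeff f v else 0 else 0)"
    unfolding nc_coeff_mult
  proof (intro sum.cong refl)
    fix i assume "i \<in> {..length w}"
    have e: "take i w = [a] \<longleftrightarrow> i = 1 \<and> b = a" if "i \<le> length w"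
      using that Cons by (cases i) (auto simp: Cons)
    show "nc_coeff (nc_gen a) (take i w) * nc_coeff f (drop i w) = (if i = 1 then if b = a then nc_coeff f v else 0 else 0)"
      using e \<open>i \<in> _\<close> by (simp add: Cons)
  qed
  then show ?thesis by (auto simp: Cons Suc_le_eq)
qed (simp add: nc_coeff_mult)

lemma nc_coeff_bracket_gen: "nc_coeff \<lbrakk>nc_gen a, f\<rbrakk> w = (if w \<noteq> [] \<and> hd w = a then nc_coeff f (tl w) else 0)
   - (if w \<noteq> [] \<and> last w = a then nc_coeff f (butlast w) else 0)"
  by (simp add: nc_bracket_def nc_coeff_gen_mult nc_coeff_mult_gen)

lemma nc_coeff_gens_mult: "nc_coeff ((nc_gen a + nc_gen b) * f) w = nc_coeff (nc_gen a * f) w + nc_coeff (nc_gen b * f) w"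
  by (simp add: distrib_right)

lemmas nc_coeff_eval = nc_coeff_bracket_gen nc_coeff_gen_mult nc_coeff_gens_mult nc_coeff_two_mult

lemma two_neq_0_CHAR_5: "CHAR('k::field) = 5 \<Longrightarrow> (2::'k) \<noteq> 0"
  using of_nat_eq_0_iff_char_dvd[of 2, where 'a='k] by simp

lemma commutator_identity_sign:
  fixes x y A B :: "(letter, 'k::field) ncs"
  assumes k: "CHAR('k) = 5"
    and x: "x = gen_x" and y: "y = gen_y"
    and A: "A = \<lbrakk>x, \<lbrakk>x, \<lbrakk>x, y\<rbrakk>\<rbrakk>\<rbrakk> + \<lbrakk>y, \<lbrakk>x, \<lbrakk>x, y\<rbrakk>\<rbrakk>\<rbrakk> + 2 * \<lbrakk>y, \<lbrakk>y, \<lbrakk>x, y\<rbrakk>\<rbrakk>\<rbrakk>"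
    and B: "B = \<lbrakk>y, \<lbrakk>y, \<lbrakk>y, x\<rbrakk>\<rbrakk>\<rbrakk> + \<lbrakk>x, \<lbrakk>y, \<lbrakk>y, x\<rbrakk>\<rbrakk>\<rbrakk> + 2 * \<lbrakk>x, \<lbrakk>x, \<lbrakk>y, x\<rbrakk>\<rbrakk>\<rbrakk>"
  shows "\<lbrakk>x, A\<rbrakk> + \<lbrakk>y, B\<rbrakk> \<noteq> x ^ 5 + y ^ 5 - (x + y) ^ 5"
proof
  let ?w = "[LX, LX, LX, LX, LY]"
  assume "\<lbrakk>x, A\<rbrakk> + \<lbrakk>y, B\<rbrakk> = x ^ 5 + y ^ 5 - (x + y) ^ 5"
  then have *: "nc_coeff (\<lbrakk>x, A\<rbrakk> + \<lbrakk>y, B\<rbrakk>) ?w = nc_coeff (x ^ 5 + y ^ 5 - (x + y) ^ 5) ?w" by simp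
  have l: "nc_coeff (\<lbrakk>x, A\<rbrakk> + \<lbrakk>y, B\<rbrakk>) ?w = 1"
    unfolding A B x y by (simp add: nc_coeff_eval)
  have r: "nc_coeff (x ^ 5 + y ^ 5 - (x + y) ^ 5) ?w = -1"
    unfolding x y by (simp add: nc_coeff_eval eval_nat_numeral)
  have "(2::'k) = 0" using * unfolding l r by (metis add.right_inverse one_add_one)
  with two_neq_0_CHAR_5[OF k] show False by simp
qed

definition cyclic_coeff :: "(letter, 'k::field) ncs \<Rightarrow> 'k" where
  "cyclic_coeff f = nc_coeff f [LX,LX,LX,LY] + nc_coeff f [LX,LX,LY,LX] + nc_coeff f [LX,LY,LX,LX] + nc_coeff f [LY,LX,LX,LX]"

lemma cyclic_coeff_commutator: "f \<in> commutator_span \<Longrightarrow> cyclic_coeff f = 0"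
  unfolding commutator_span_def
proof (induction rule: ncs.span_induct_alt)
  case base show ?case by (simp add: cyclic_coeff_def)
next
  case (step c f g)
  then obtain a b where f: "f = a * b - b * a" by auto
  have "cyclic_coeff f = 0" unfolding f by (simp add: cyclic_coeff_def nc_coeff_mult algebra_simps)
  moreover have "cyclic_coeff (nc_scale c f + g) = c * cyclic_coeff f + cyclic_coeff g" by (simp add: cyclic_coeff_def algebra_simps)
  ultimately show ?case using step by simp
qed

lemma trace_identity_sign:
  fixes x y A B :: "(letter, 'k::field) ncs"
  assumes k: "CHAR('k) = 5"
    and x: "x = gen_x" and y: "y = gen_y"
    and A: "A = \<lbrakk>x, \<lbrakk>x, \<lbrakk>x, y\<rbrakk>\<rbrakk>\<rbrakk> + \<lbrakk>y, \<lbrakk>x, \<lbrakk>x, y\<rbrakk>\<rbrakk>\<rbrakk> + 2 * \<lbrakk>y, \<lbrakk>y, \<lbrakk>x, y\<rbrakk>\<rbrakk>\<rbrakk>"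
    and B: "B = \<lbrakk>y, \<lbrakk>y, \<lbrakk>y, x\<rbrakk>\<rbrakk>\<rbrakk> + \<lbrakk>x, \<lbrakk>y, \<lbrakk>y, x\<rbrakk>\<rbrakk>\<rbrakk> + 2 * \<lbrakk>x, \<lbrakk>x, \<lbrakk>y, x\<rbrakk>\<rbrakk>\<rbrakk>"
  shows "nc_tr (x * partial_x A + y * partial_y B) \<noteq> tr_scale (1 / 2) (nc_tr (x ^ 4 + y ^ 4 - (x + y) ^ 4))"
proof
  let ?L = "x * partial_x A + y * partial_y B" and ?R = "x ^ 4 + y ^ 4 - (x + y) ^ 4"
  have sub: "ncs.subspace (commutator_span :: (letter, 'k) ncs set)" unfolding commutator_span_def by simp
  assume "nc_tr ?L = tr_scale (1/2) (nc_tr ?R)"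
  then have "?L - nc_scale (1/2) ?R \<in> commutator_span"
    unfolding nc_tr_def tr_scale_def coset_scale_nc_coset[OF sub] nc_coset_eq_iff[OF sub] .
  then have *: "cyclic_coeff (?L - nc_scale (1/2) ?R) = 0" by (rule cyclic_coeff_commutator)
  have l: "cyclic_coeff ?L = -3"
    unfolding A B x y cyclic_coeff_def
    by (simp add: nc_coeff_eval nc_coeff_partial_x nc_coeff_partial_y)
  have r: "cyclic_coeff ?R = -4"
    unfolding x y cyclic_coeff_def by (simp add: nc_coeff_eval eval_nat_numeral)
  have "cyclic_coeff (?L - nc_scale (1/2) ?R) = cyclic_coeff ?L - 1/2 * cyclic_coeff ?R"
    by (simp add: cyclic_coeff_def algebra_simps)
  then have "(-1::'k) = 0" unfolding * l r using two_neq_0_CHAR_5[OF k] by (simp add: field_simps)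
  then show False by simp
qed

end

theory Submission
  imports Defs
begin

text \<open>
  All elements involved are homogeneous of degree at most 5, so every claim that takes place in a
  free algebra is an identity between two explicit non-commutative polynomials with integer
  coefficients, read modulo 5.  Such identities hold in every ring of characteristic 5, and
  \<open>hvanish_imp_hval_eq_0\<close> reduces them to a computation with coefficients.  This settles the
  commutator identity, the values \<open>\<psi>(-x-y, x) = A(x, y)\<close> and \<open>\<psi>(-x-y, y) = A(y, x) = B(x, y)\<close>,
  antisymmetry and the hexagon.  For the trace identity, the difference of the two sides is
  exhibited as \<open>[x, P] + [y, Q]\<close>.

  The pentagon is an identity in the quotient \<open>t_4\<close>.  Write \<open>a, b, c\<close> for \<open>t^{1,2}, t^{1,3}, t^{2,3}\<close>
  and \<open>d, e, f\<close> for \<open>t^{1,4}, t^{2,4}, t^{3,4}\<close>.  The defining relations say that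
  \<open>a, b, c\<close> act on the Lie algebra generated by \<open>d, e, f\<close> by derivations, so \<open>t_4\<close> is a semidirect
  product of \<open>t_3\<close> with that (free) Lie algebra, and the pentagon can be projected to both factors.
  In the \<open>t_3\<close> factor only \<open>\<psi>(a, c)\<close> survives, on both sides.  For the other factor, three of the
  five terms are values of \<open>\<psi>\<close> at two elements \<open>u, v\<close> that together with a third element \<open>w\<close>
  satisfy the relations of \<open>t_3\<close>.  Then \<open>u + v + w\<close> commutes with all three, so
  \<open>u\<close> may be replaced by \<open>- v - w\<close> (\<open>quartic_psi_shift\<close>); this gives
  \<open>\<psi>(c, f) = A(f, e)\<close>, \<open>\<psi>(b + c, f) = A(f, d + e)\<close> and \<open>\<psi>(a + b, e + f) = A(e + f, d)\<close>.
  What remains is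
  \<open>\<psi>(a, c + e) - \<psi>(a, c) = A(f, e) + A(e + f, d) - A(f, d + e)\<close>.  Its left-hand side is computed by
  the multiplication rule of the semidirect product (\<open>quartic_psi_splits\<close>), which turns it into
  a polynomial identity in \<open>d, e, f\<close> modulo 5.

  All congruences are established by exhibiting the difference as an element of the Lie ideal of
  relations; as it is homogeneous of degree 4, it then lies in the completed ideal.
\<close>


section \<open>Basic algebra of series\<close>

lemma numeral_mult_eq_scale: "numeral n * f = nc_scale (numeral n) f"
  for f :: "('a, 'k::field) ncs"
proof -
  have "of_nat m * f = nc_scale (of_nat m) f" for m
    by (induction m) (simp_all add: distrib_right ncs.scale_left_distrib)
  from this[of "numeral n"] show ?thesis by simp
qed

lemma five_eq_0:
  assumes "CHAR('k::field) = 5"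
  shows "(of_int 5 :: ('a, 'k) ncs) = 0"
proof -
  have "(5 :: 'k) = 0"
    using of_nat_CHAR[where 'a = 'k] assms by simp
  then show ?thesis
    using numeral_mult_eq_scale[of "num.Bit1 (num.Bit0 num.One)" "1 :: ('a, 'k) ncs"] by simp
qed

lemma nc_bracket_linear:
  "\<lbrakk>f + g, h\<rbrakk> = \<lbrakk>f, h\<rbrakk> + \<lbrakk>g, h\<rbrakk>" "\<lbrakk>h, f + g\<rbrakk> = \<lbrakk>h, f\<rbrakk> + \<lbrakk>h, g\<rbrakk>"
  "\<lbrakk>f - g, h\<rbrakk> = \<lbrakk>f, h\<rbrakk> - \<lbrakk>g, h\<rbrakk>" "\<lbrakk>h, f - g\<rbrakk> = \<lbrakk>h, f\<rbrakk> - \<lbrakk>h, g\<rbrakk>"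
  "\<lbrakk>- f, h\<rbrakk> = - \<lbrakk>f, h\<rbrakk>" "\<lbrakk>h, - f\<rbrakk> = - \<lbrakk>h, f\<rbrakk>"
  by (simp_all add: nc_bracket_def algebra_simps)

definition homogeneous :: "nat \<Rightarrow> ('a, 'k::comm_ring_1) ncs \<Rightarrow> bool" where
  "homogeneous n f \<longleftrightarrow> (\<forall>w. length w \<noteq> n \<longrightarrow> nc_coeff f w = 0)"

lemma homogeneous_gen: "homogeneous 1 (nc_gen a)"
  by (auto simp: homogeneous_def)

lemma homogeneous_add: "homogeneous n f \<Longrightarrow> homogeneous n g \<Longrightarrow> homogeneous n (f + g)"
  by (simp add: homogeneous_def)

lemma homogeneous_diff: "homogeneous n f \<Longrightarrow> homogeneous n g \<Longrightarrow> homogeneous n (f - g)"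
  by (simp add: homogeneous_def)

lemma homogeneous_numeral: "homogeneous n f \<Longrightarrow> homogeneous n (numeral k * f)"
  for f :: "('a, 'k::field) ncs"
  by (simp add: numeral_mult_eq_scale homogeneous_def)

lemma homogeneous_mult:
  assumes "homogeneous m f" "homogeneous n g"
  shows "homogeneous (m + n) (f * g)"
  unfolding homogeneous_def nc_coeff_mult
proof (intro allI impI sum.neutral ballI)
  fix w :: "'a list" and i assume "length w \<noteq> m + n" "i \<in> {..length w}"
  then have "length (take i w) \<noteq> m \<or> length (drop i w) \<noteq> n" by auto
  then show "nc_coeff f (take i w) * nc_coeff g (drop i w) = 0"
    using assms unfolding homogeneous_def by auto
qed

lemma homogeneous_bracket:
  assumes "homogeneous m f" "homogeneous n g"
  shows "homogeneous (m + n) \<lbrakk>f, g\<rbrakk>"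
  using homogeneous_diff[OF homogeneous_mult[OF assms]
      homogeneous_mult[OF assms(2,1), unfolded add.commute[of n]]]
  by (simp add: nc_bracket_def)

lemma homogeneous_in_completion:
  assumes "homogeneous n f" "f \<in> S" "0 \<in> S"
  shows "f \<in> nc_completion S"
  unfolding nc_completion_def
proof (intro CollectI allI)
  fix d
  have "nc_part d f = (if d = n then f else 0)"
    by (rule ncs_eqI) (use assms(1) in \<open>auto simp: homogeneous_def\<close>)
  then show "nc_part d f \<in> S" using assms by simp
qed

lemma nc_subst_bracket:
  fixes u v :: "('a, 'k::field) ncs"
  assumes "nc_coeff u [] = 0" "nc_coeff v [] = 0"
  shows "nc_subst u v \<lbrakk>f, g\<rbrakk> = \<lbrakk>nc_subst u v f, nc_subst u v g\<rbrakk>"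
proof -
  have "nc_subst u v (f * g + nc_scale (-1) (g * f))
      = nc_subst u v f * nc_subst u v g + nc_scale (-1) (nc_subst u v g * nc_subst u v f)"
    by (simp only: nc_subst_add nc_subst_scale nc_subst_mult[OF assms])
  then show ?thesis by (simp add: nc_bracket_def)
qed

text \<open>The last letter of a word comes from \<open>g\<close> unless \<open>g\<close> contributes the empty word.\<close>

lemma partial_mult:
  "partial_x (f * g) = f * partial_x g + nc_scale (nc_coeff g []) (partial_x f)"
  "partial_y (f * g) = f * partial_y g + nc_scale (nc_coeff g []) (partial_y f)"
  by (rule ncs_eqI; simp add: nc_coeff_partial_x nc_coeff_partial_y nc_coeff_mult)+

lemma nc_coeff_bracket_Nil: "nc_coeff \<lbrakk>f, g\<rbrakk> [] = 0"
  by (simp add: nc_bracket_def nc_coeff_mult)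

lemma partial_simps:
  "partial_x (f + g) = partial_x f + partial_x g" "partial_y (f + g) = partial_y f + partial_y g"
  "partial_x (f - g) = partial_x f - partial_x g" "partial_y (f - g) = partial_y f - partial_y g"
  "partial_x (nc_scale c f) = nc_scale c (partial_x f)"
  "partial_y (nc_scale c f) = nc_scale c (partial_y f)"
  "partial_x gen_x = 1" "partial_x gen_y = 0" "partial_y gen_x = 0" "partial_y gen_y = 1"
  by (rule ncs_eqI; simp add: nc_coeff_partial_x nc_coeff_partial_y)+


lemma partial_bracket:
  assumes "nc_coeff f [] = 0"
  shows "partial_x \<lbrakk>gen_x, f\<rbrakk> = gen_x * partial_x f - f" "partial_x \<lbrakk>gen_y, f\<rbrakk> = gen_y * partial_x f"
    "partial_y \<lbrakk>gen_y, f\<rbrakk> = gen_y * partial_y f - f" "partial_y \<lbrakk>gen_x, f\<rbrakk> = gen_x * partial_y f"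
  by (simp_all add: nc_bracket_def partial_simps partial_mult assms)

section \<open>Deciding identities between non-commutative polynomials\<close>

text \<open>
  A polynomial in three non-commuting variables is stored in Horner form
  \<open>c + x p + y q + z r\<close>.  Addition is then structural and multiplication recurses on the left factor
  only, so that \<open>hvanish m p\<close> can be decided by rewriting for closed \<open>p\<close>, without ever sorting
  or comparing words.
\<close>

datatype horner = Zero | Node int horner horner horner

fun hval :: "'r \<Rightarrow> 'r \<Rightarrow> 'r \<Rightarrow> horner \<Rightarrow> 'r::ring_1" where
  "hval x y z Zero = 0"
| "hval x y z (Node c p q r) = of_int c + x * hval x y z p + y * hval x y z q + z * hval x y z r"

fun hscale :: "int \<Rightarrow> horner \<Rightarrow> horner" where
  "hscale k Zero = Zero"
| "hscale k (Node c p q r) = Node (k * c) (hscale k p) (hscale k q) (hscale k r)"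

fun hvanish :: "int \<Rightarrow> horner \<Rightarrow> bool" where
  "hvanish m Zero = True"
| "hvanish m (Node c p q r) \<longleftrightarrow> c mod m = 0 \<and> hvanish m p \<and> hvanish m q \<and> hvanish m r"

instantiation horner :: "{one, plus, minus, times, power}"
begin

definition one_horner :: horner where
  "one_horner = Node 1 Zero Zero Zero"

fun plus_horner :: "horner \<Rightarrow> horner \<Rightarrow> horner" where
  "plus_horner Zero s = s"
| "plus_horner (Node c p q r) Zero = Node c p q r"
| "plus_horner (Node c p q r) (Node c' p' q' r') =
     Node (c + c') (plus_horner p p') (plus_horner q q') (plus_horner r r')"

definition minus_horner :: "horner \<Rightarrow> horner \<Rightarrow> horner" where
  "minus_horner p q = p + hscale (-1) q"

fun times_horner :: "horner \<Rightarrow> horner \<Rightarrow> horner" where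
  "times_horner Zero s = Zero"
| "times_horner (Node c p q r) s =
     (if c = 0 then Zero else hscale c s) +
     Node 0 (times_horner p s) (times_horner q s) (times_horner r s)"

instance ..

end

definition hX :: horner where "hX = Node 0 1 Zero Zero"
definition hY :: horner where "hY = Node 0 Zero 1 Zero"
definition hZ :: horner where "hZ = Node 0 Zero Zero 1"

definition hbr :: "horner \<Rightarrow> horner \<Rightarrow> horner" where
  "hbr p q = p * q - q * p"

lemma hval_var: "hval x y z hX = x" "hval x y z hY = y" "hval x y z hZ = z"
  by (simp_all add: hX_def hY_def hZ_def one_horner_def)

lemma hval_add: "hval x y z (p + q) = hval x y z p + hval x y z q"
  by (induction p q rule: plus_horner.induct) (simp_all add: algebra_simps)

lemma hval_scale: "hval x y z (hscale k p) = of_int k * hval x y z p"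
proof (induction p)
  case (Node c p q r)
  have "a * (of_int k * b) = of_int k * (a * b)" for a b :: 'a
    by (metis mult.assoc mult_of_int_commute)
  then show ?case by (simp add: Node distrib_left)
qed simp

lemma hval_diff: "hval x y z (p - q) = hval x y z p - hval x y z q"
  by (simp add: minus_horner_def hval_add hval_scale)

lemma hval_mult: "hval x y z (p * q) = hval x y z p * hval x y z q"
  by (induction p) (simp_all add: hval_add hval_scale algebra_simps)

lemma hval_power: "hval x y z (p ^ n) = hval x y z p ^ n"
  by (induction n) (simp_all add: hval_mult one_horner_def)

lemma hval_bracket: "hval x y z (hbr p q) = \<lbrakk>hval x y z p, hval x y z q\<rbrakk>"
  by (simp add: hbr_def nc_bracket_def hval_diff hval_mult)

lemmas hval_ops = hval_var hval_add hval_diff hval_scale hval_mult hval_power hval_bracket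

lemma hvanish_imp_hval_eq_0:
  fixes x :: "'r::ring_1"
  assumes "hvanish m p" "(of_int m :: 'r) = 0"
  shows "hval x y z p = 0"
  using assms(1)
proof (induction p)
  case (Node c p q r)
  then obtain d where "c = m * d" by auto
  then show ?case using Node assms(2) by simp
qed simp


section \<open>The quartic Lie polynomials\<close>

definition lie_quartic_A :: "('a, 'k::field) ncs \<Rightarrow> ('a, 'k) ncs \<Rightarrow> ('a, 'k) ncs" where
  "lie_quartic_A u v = \<lbrakk>u, \<lbrakk>u, \<lbrakk>u, v\<rbrakk>\<rbrakk>\<rbrakk> + \<lbrakk>v, \<lbrakk>u, \<lbrakk>u, v\<rbrakk>\<rbrakk>\<rbrakk> + 2 * \<lbrakk>v, \<lbrakk>v, \<lbrakk>u, v\<rbrakk>\<rbrakk>\<rbrakk>"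

definition lie_quartic_psi :: "('a, 'k::field) ncs \<Rightarrow> ('a, 'k) ncs \<Rightarrow> ('a, 'k) ncs" where
  "lie_quartic_psi u v =
     2 * \<lbrakk>u, \<lbrakk>u, \<lbrakk>u, v\<rbrakk>\<rbrakk>\<rbrakk> + 2 * \<lbrakk>v, \<lbrakk>v, \<lbrakk>u, v\<rbrakk>\<rbrakk>\<rbrakk> + 3 * \<lbrakk>v, \<lbrakk>u, \<lbrakk>u, v\<rbrakk>\<rbrakk>\<rbrakk>"

definition hA :: "horner \<Rightarrow> horner \<Rightarrow> horner" where
  "hA u v = hbr u (hbr u (hbr u v)) + hbr v (hbr u (hbr u v)) + hscale 2 (hbr v (hbr v (hbr u v)))"

definition hpsi :: "horner \<Rightarrow> horner \<Rightarrow> horner" where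
  "hpsi u v = hscale 2 (hbr u (hbr u (hbr u v))) + hscale 2 (hbr v (hbr v (hbr u v)))
     + hscale 3 (hbr v (hbr u (hbr u v)))"

lemma hval_quartic:
  "hval x y z (hA p q) = lie_quartic_A (hval x y z p) (hval x y z q)"
  "hval x y z (hpsi p q) = lie_quartic_psi (hval x y z p) (hval x y z q)"
  by (simp_all add: hA_def hpsi_def lie_quartic_A_def lie_quartic_psi_def hval_ops)

text \<open>
  Substitution is a homomorphism only for series without constant term, as a constant term would
  let infinitely many words contribute to one coefficient.
\<close>

lemma nc_subst_quartic_psi:
  fixes u v :: "('a, 'k::field) ncs"
  assumes "nc_coeff u [] = 0" "nc_coeff v [] = 0"
  shows "nc_subst u v (lie_quartic_psi gen_x gen_y) = lie_quartic_psi u v"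
  by (simp add: lie_quartic_psi_def numeral_mult_eq_scale nc_subst_add nc_subst_scale
      nc_subst_bracket[OF assms] nc_subst_gen[OF assms])

lemma homogeneous_quartic:
  fixes u v :: "('a, 'k::field) ncs"
  assumes "homogeneous 1 u" "homogeneous 1 v"
  shows "homogeneous 4 (lie_quartic_A u v)" "homogeneous 4 (lie_quartic_psi u v)"
proof -
  have "homogeneous 2 \<lbrakk>u, v\<rbrakk>"
    using homogeneous_bracket[OF assms] by (simp only: one_add_one)
  moreover have "homogeneous 3 \<lbrakk>f, g\<rbrakk>" if "homogeneous 1 f" "homogeneous 2 g" for f g :: "('a, 'k) ncs"
    using homogeneous_bracket[OF that] by (simp add: eval_nat_numeral)
  moreover have "homogeneous 4 \<lbrakk>f, g\<rbrakk>" if "homogeneous 1 f" "homogeneous 3 g" for f g :: "('a, 'k) ncs"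
    using homogeneous_bracket[OF that] by (simp add: eval_nat_numeral)
  ultimately show "homogeneous 4 (lie_quartic_A u v)" "homogeneous 4 (lie_quartic_psi u v)"
    unfolding lie_quartic_A_def lie_quartic_psi_def
    by (simp_all add: assms homogeneous_add homogeneous_numeral del: One_nat_def)
qed

lemma quartic_in_lie_generated:
  fixes u v :: "('a, 'k::field) ncs"
  assumes "u \<in> lie_generated G" "v \<in> lie_generated G"
  shows "lie_quartic_A u v \<in> lie_generated G" "lie_quartic_psi u v \<in> lie_generated G"
  unfolding lie_quartic_A_def lie_quartic_psi_def numeral_mult_eq_scale
  by (intro lie_generated.add lie_generated.scale lie_generated.bracket assms)+

lemma quartic_in_lie2:
  assumes "{u, v} \<subseteq> {gen_x, gen_y}"
  shows "lie_quartic_A u v \<in> lie2" "lie_quartic_psi u v \<in> lie2"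
proof -
  have h: "homogeneous 1 u" "homogeneous 1 v"
    using assms homogeneous_gen by auto
  have g: "u \<in> lie_generated {gen_x, gen_y}" "v \<in> lie_generated {gen_x, gen_y}"
    using assms by (auto intro: lie_generated.gen)
  show "lie_quartic_A u v \<in> lie2" "lie_quartic_psi u v \<in> lie2"
    unfolding lie2_def
    by (rule homogeneous_in_completion[OF _ _ lie_generated.zero],
        rule homogeneous_quartic[OF h] quartic_in_lie_generated[OF g],
        rule quartic_in_lie_generated[OF g])+
qed

context
  assumes char5: "CHAR('k::field) = 5"
begin

lemmas vanish5 = hvanish_imp_hval_eq_0[OF _ five_eq_0[OF char5]]

text \<open>
  Arbitrary \<open>u, v\<close> are allowed because the pentagon uses these formulas for elements of the free
  Lie algebra on the \<open>t^{i,j}\<close>.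
\<close>

lemma psi_cyclic:
  fixes u v :: "('a, 'k) ncs"
  shows "lie_quartic_psi (- u - v) u = lie_quartic_A u v"
    and "lie_quartic_psi (- u - v) v = lie_quartic_A v u"
proof -
  let ?w = "hscale (-1) hX - hY"
  have "hvanish 5 (hpsi ?w hX - hA hX hY)" by code_simp
  from vanish5[OF this, of u v 0] show "lie_quartic_psi (- u - v) u = lie_quartic_A u v"
    by (simp add: hval_quartic hval_ops)
  have "hvanish 5 (hpsi ?w hY - hA hY hX)" by code_simp
  from vanish5[OF this, of u v 0] show "lie_quartic_psi (- u - v) v = lie_quartic_A v u"
    by (simp add: hval_quartic hval_ops)
qed

lemma psi_antisymmetric: "lie_quartic_psi u v = - lie_quartic_psi v u"
  for u v :: "('a, 'k) ncs"
proof -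
  have "hvanish 5 (hpsi hX hY + hpsi hY hX)" by code_simp
  from vanish5[OF this, of u v 0] show ?thesis
    by (simp add: hval_quartic hval_ops add_eq_0_iff2)
qed

lemma psi_hexagon:
  fixes u v :: "('a, 'k) ncs"
  shows "lie_quartic_psi u v + lie_quartic_psi v (- u - v) + lie_quartic_psi (- u - v) u = 0"
proof -
  have "hvanish 5 (let w = hscale (-1) hX - hY in hpsi hX hY + hpsi hY w + hpsi w hX)" by code_simp
  from vanish5[OF this, of u v 0] show ?thesis
    by (simp add: Let_def hval_quartic hval_ops)
qed

lemma commutator_identity:
  fixes u v :: "('a, 'k) ncs"
  shows "\<lbrakk>u, lie_quartic_A u v\<rbrakk> + \<lbrakk>v, lie_quartic_A v u\<rbrakk> = (u + v) ^ 5 - u ^ 5 - v ^ 5"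
proof -
  have "hvanish 5 (hbr hX (hA hX hY) + hbr hY (hA hY hX) - ((hX + hY) ^ 5 - hX ^ 5 - hY ^ 5))"
    by code_simp
  from vanish5[OF this, of u v 0] show ?thesis
    by (simp add: hval_quartic hval_ops)
qed

lemma trace_identity:
  fixes x y :: "(letter, 'k) ncs"
  assumes "x = gen_x" "y = gen_y"
  shows "nc_tr (x * partial_x (lie_quartic_A x y) + y * partial_y (lie_quartic_A y x))
    = tr_scale (1 / 2) (nc_tr ((x + y) ^ 4 - x ^ 4 - y ^ 4))"
proof -
  have sub: "ncs.subspace (commutator_span :: (letter, 'k) ncs set)"
    by (simp add: commutator_span_def)
  have comm: "\<lbrakk>f, g\<rbrakk> \<in> commutator_span" for f g :: "(letter, 'k) ncs"
    unfolding commutator_span_def nc_bracket_def by (rule ncs.span_base) blast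
  have half: "(1 / 2 :: 'k) = 3"
  proof -
    have "(2 :: 'k) \<noteq> 0" "(5 :: 'k) = 0"
      using two_neq_0_CHAR_5[OF char5] of_nat_CHAR[where 'a = 'k] char5 by simp_all
    moreover have "(2 :: 'k) * 3 = 5 + 1" by simp
    ultimately show ?thesis by (simp add: field_simps)
  qed
  have dA: "partial_x (lie_quartic_A x y) = x * (- (x * y) - \<lbrakk>x, y\<rbrakk>) - \<lbrakk>x, \<lbrakk>x, y\<rbrakk>\<rbrakk>
      + y * (- (x * y) - \<lbrakk>x, y\<rbrakk>) - 2 * (y * (y * y))"
    unfolding lie_quartic_A_def numeral_mult_eq_scale
    by (simp add: partial_simps partial_bracket nc_coeff_bracket_Nil assms ncs.scale_minus_right)
  have dB: "partial_y (lie_quartic_A y x) = y * (- (y * x) - \<lbrakk>y, x\<rbrakk>) - \<lbrakk>y, \<lbrakk>y, x\<rbrakk>\<rbrakk>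
      + x * (- (y * x) - \<lbrakk>y, x\<rbrakk>) - 2 * (x * (x * x))"
    unfolding lie_quartic_A_def numeral_mult_eq_scale
    by (simp add: partial_simps partial_bracket nc_coeff_bracket_Nil assms ncs.scale_minus_right)
  \<comment> \<open>In each class of words up to rotation the coefficients of the difference add up to 0.  As
      \<open>l w - w l = [l, w]\<close> for a letter \<open>l\<close>, the partial sums of the coefficients along the rotation
      class are the coefficients of \<open>P\<close> (for \<open>l = x\<close>) and \<open>Q\<close> (for \<open>l = y\<close>).\<close>
  let ?P = "4 * (x * x * y) + 4 * (x * y * x) + 3 * (y * y * x)"
  let ?Q = "3 * (x * x * y) + 4 * (y * y * x) + 4 * (y * x * y)"
  have "hvanish 5 (let H = hbr hX hY;
        K = hscale (-1) (hX * hY) - H; K' = hscale (-1) (hY * hX) - hbr hY hX;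
        P = hscale 4 (hX * hX * hY) + hscale 4 (hX * hY * hX) + hscale 3 (hY * hY * hX);
        Q = hscale 3 (hX * hX * hY) + hscale 4 (hY * hY * hX) + hscale 4 (hY * hX * hY)
      in hX * (hX * K - hbr hX H + hY * K - hscale 2 (hY * (hY * hY)))
       + hY * (hY * K' - hbr hY (hbr hY hX) + hX * K' - hscale 2 (hX * (hX * hX)))
       - hscale 3 ((hX + hY) ^ 4 - hX ^ 4 - hY ^ 4) - (hbr hX P + hbr hY Q))"
    by code_simp
  from vanish5[OF this, of x y 0]
  have "x * partial_x (lie_quartic_A x y) + y * partial_y (lie_quartic_A y x)
      - 3 * ((x + y) ^ 4 - x ^ 4 - y ^ 4) = \<lbrakk>x, ?P\<rbrakk> + \<lbrakk>y, ?Q\<rbrakk>"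
    unfolding Let_def hval_ops dA dB by simp
  also have "\<dots> \<in> commutator_span"
    by (intro ncs.subspace_add[OF sub] comm)
  finally show ?thesis
    unfolding nc_tr_def tr_scale_def coset_scale_nc_coset[OF sub] nc_coset_eq_iff[OF sub] half
    by (simp only: numeral_mult_eq_scale)
qed

end


section \<open>Lie algebras given by generators and relations\<close>

text \<open>
  The presented Lie algebra \<open>L / I\<close> is not formed as a type: \<open>I\<close> is closed under brackets with \<open>L\<close>
  only, not with arbitrary series, so every congruence modulo \<open>I\<close> has to carry membership in \<open>L\<close>.
  The predicates below bundle the two.
\<close>

locale lie_presentation =
  fixes G R :: "('a, 'k::field) ncs set"
begin

abbreviation L :: "('a, 'k) ncs set" where "L \<equiv> lie_generated G"
abbreviation I :: "('a, 'k) ncs set" where "I \<equiv> lie_ideal L R"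

lemma L_uminus: "f \<in> L \<Longrightarrow> - f \<in> L"
  by (rule ncs.subspace_neg[OF subspace_lie_generated])

lemma L_diff: "f \<in> L \<Longrightarrow> g \<in> L \<Longrightarrow> f - g \<in> L"
  by (rule ncs.subspace_diff[OF subspace_lie_generated])

lemmas L_closed = lie_generated.zero lie_generated.add lie_generated.bracket L_uminus L_diff

lemma I_uminus: "f \<in> I \<Longrightarrow> - f \<in> I"
  by (rule ncs.subspace_neg[OF subspace_lie_ideal])

lemma I_diff: "f \<in> I \<Longrightarrow> g \<in> I \<Longrightarrow> f - g \<in> I"
  by (rule ncs.subspace_diff[OF subspace_lie_ideal])

lemma I_numeral: "f \<in> I \<Longrightarrow> numeral n * f \<in> I"
  unfolding numeral_mult_eq_scale by (rule lie_ideal.scale)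

lemma I_bracket_right: "g \<in> I \<Longrightarrow> f \<in> L \<Longrightarrow> \<lbrakk>g, f\<rbrakk> \<in> I"
  using I_uminus[OF lie_ideal.bracket[of f L g R]] by (simp add: nc_bracket_def)

lemmas I_closed = lie_ideal.zero lie_ideal.add lie_ideal.bracket I_uminus I_diff I_numeral
  I_bracket_right

text \<open>
  The adjoint action in \<open>L / I\<close>, with representatives.  The rules below say that \<open>X\<close> acts by a
  derivation and that commutators act by commutators of derivations.  They compute the action of
  every Lie word once the action on generators is known.
\<close>

definition acts :: "('a, 'k) ncs \<Rightarrow> ('a, 'k) ncs \<Rightarrow> ('a, 'k) ncs \<Rightarrow> bool" where
  "acts X f g \<longleftrightarrow> X \<in> L \<and> f \<in> L \<and> g \<in> L \<and> \<lbrakk>X, f\<rbrakk> - g \<in> I"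

lemma acts_add: "acts X f f' \<Longrightarrow> acts X g g' \<Longrightarrow> acts X (f + g) (f' + g')"
  using lie_ideal.add[of "\<lbrakk>X, f\<rbrakk> - f'" L R "\<lbrakk>X, g\<rbrakk> - g'"]
  by (simp add: acts_def L_closed nc_bracket_linear algebra_simps)

lemma acts_uminus: "acts X f f' \<Longrightarrow> acts X (- f) (- f')"
  using I_uminus[of "\<lbrakk>X, f\<rbrakk> - f'"]
  by (simp add: acts_def L_closed nc_bracket_linear algebra_simps)

lemma acts_diff: "acts X f f' \<Longrightarrow> acts X g g' \<Longrightarrow> acts X (f - g) (f' - g')"
  using acts_add[OF _ acts_uminus] by fastforce

lemma acts_zero: "X \<in> L \<Longrightarrow> acts X 0 0"
  by (simp add: acts_def nc_bracket_def I_closed L_closed)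

lemma acts_bracket:
  assumes "acts X f f'" "acts X g g'"
  shows "acts X \<lbrakk>f, g\<rbrakk> (\<lbrakk>f', g\<rbrakk> + \<lbrakk>f, g'\<rbrakk>)"
proof -
  have "\<lbrakk>\<lbrakk>X, f\<rbrakk> - f', g\<rbrakk> + \<lbrakk>f, \<lbrakk>X, g\<rbrakk> - g'\<rbrakk> \<in> I"
    using assms by (simp only: acts_def I_closed)
  moreover have "\<lbrakk>\<lbrakk>X, f\<rbrakk> - f', g\<rbrakk> + \<lbrakk>f, \<lbrakk>X, g\<rbrakk> - g'\<rbrakk> = \<lbrakk>X, \<lbrakk>f, g\<rbrakk>\<rbrakk> - (\<lbrakk>f', g\<rbrakk> + \<lbrakk>f, g'\<rbrakk>)"
    by (simp add: nc_bracket_def algebra_simps)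
  ultimately show ?thesis
    using assms by (simp add: acts_def L_closed)
qed

lemma acts_commutator:
  assumes "acts X f fX" "acts Y f fY" "acts X fY fYX" "acts Y fX fXY"
  shows "acts \<lbrakk>X, Y\<rbrakk> f (fYX - fXY)"
proof -
  have "\<lbrakk>X, \<lbrakk>Y, f\<rbrakk> - fY\<rbrakk> - \<lbrakk>Y, \<lbrakk>X, f\<rbrakk> - fX\<rbrakk> + (\<lbrakk>X, fY\<rbrakk> - fYX) - (\<lbrakk>Y, fX\<rbrakk> - fXY) \<in> I"
    using assms by (simp only: acts_def I_closed)
  moreover have "\<lbrakk>X, \<lbrakk>Y, f\<rbrakk> - fY\<rbrakk> - \<lbrakk>Y, \<lbrakk>X, f\<rbrakk> - fX\<rbrakk> + (\<lbrakk>X, fY\<rbrakk> - fYX) - (\<lbrakk>Y, fX\<rbrakk> - fXY)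
      = \<lbrakk>\<lbrakk>X, Y\<rbrakk>, f\<rbrakk> - (fYX - fXY)"
    by (simp add: nc_bracket_def algebra_simps)
  ultimately show ?thesis
    using assms by (simp add: acts_def L_closed)
qed

text \<open>This is how a relation of \<open>t_n\<close> becomes a statement on the action of one generator on another.\<close>

lemma acts_of_bracket_in_I:
  assumes "X \<in> L" "f \<in> L" "g \<in> L" "\<lbrakk>f, X + g\<rbrakk> \<in> I"
  shows "acts X f \<lbrakk>f, g\<rbrakk>"
  using assms I_uminus[OF assms(4)] unfolding acts_def
  by (simp add: L_closed) (simp add: nc_bracket_def algebra_simps)

text \<open>
  If the derivation \<open>X\<close> agrees with the inner derivation \<open>f \<mapsto> [f, p]\<close> on two elements, then also
  on their bracket; this keeps the computed actions short.
\<close>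

lemma acts_inner:
  assumes "acts X f \<lbrakk>f, p\<rbrakk>" "acts X g \<lbrakk>g, p\<rbrakk>"
  shows "acts X \<lbrakk>f, g\<rbrakk> \<lbrakk>\<lbrakk>f, g\<rbrakk>, p\<rbrakk>"
  using acts_bracket[OF assms] by (simp add: nc_bracket_def algebra_simps)

text \<open>
  \<open>splits z X p\<close> writes the class of \<open>z\<close> as \<open>X + p\<close>, to be read as the element \<open>(X, p)\<close> of a
  semidirect product in which \<open>X\<close> acts by derivations on the ideal containing \<open>p\<close>.  The bracket rule
  is that of the semidirect product.
\<close>

definition splits :: "('a, 'k) ncs \<Rightarrow> ('a, 'k) ncs \<Rightarrow> ('a, 'k) ncs \<Rightarrow> bool" where
  "splits z X p \<longleftrightarrow> z \<in> L \<and> X \<in> L \<and> p \<in> L \<and> z - (X + p) \<in> I"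

lemma splits_bracket:
  assumes "splits z X p" "splits w Y q" "acts X q q'" "acts Y p p'"
  shows "splits \<lbrakk>z, w\<rbrakk> \<lbrakk>X, Y\<rbrakk> (q' - p' + \<lbrakk>p, q\<rbrakk>)"
proof -
  have "\<lbrakk>z - (X + p), w\<rbrakk> + \<lbrakk>X + p, w - (Y + q)\<rbrakk> + (\<lbrakk>X, q\<rbrakk> - q') - (\<lbrakk>Y, p\<rbrakk> - p') \<in> I"
    using assms by (simp only: acts_def splits_def I_closed L_closed)
  moreover have "\<lbrakk>z - (X + p), w\<rbrakk> + \<lbrakk>X + p, w - (Y + q)\<rbrakk> + (\<lbrakk>X, q\<rbrakk> - q') - (\<lbrakk>Y, p\<rbrakk> - p')
      = \<lbrakk>z, w\<rbrakk> - (\<lbrakk>X, Y\<rbrakk> + (q' - p' + \<lbrakk>p, q\<rbrakk>))"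
    by (simp add: nc_bracket_def algebra_simps)
  ultimately show ?thesis
    using assms by (simp add: acts_def splits_def L_closed)
qed

text \<open>
  The hypotheses make \<open>c = u + v + w\<close> commute with \<open>u\<close>, \<open>v\<close> and \<open>w\<close>, hence with all Lie words in them.
  As \<open>u\<close> and \<open>- v - w\<close> differ by \<open>c\<close>, and \<open>\<psi>\<close> has no linear part, \<open>u\<close> can be replaced by
  \<open>- v - w\<close> one bracket at a time.
\<close>

lemma quartic_psi_shift:
  assumes uvw: "u \<in> L" "v \<in> L" "w \<in> L"
    and rel: "\<lbrakk>u, v + w\<rbrakk> \<in> I" "\<lbrakk>v, w + u\<rbrakk> \<in> I" "\<lbrakk>w, u + v\<rbrakk> \<in> I"
  shows "lie_quartic_psi u v - lie_quartic_psi (- v - w) v \<in> I"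
proof -
  let ?c = "u + v + w" and ?u = "- v - w"
  have central_v: "acts ?c v 0" and central_w: "acts ?c w 0"
    using uvw I_uminus[OF rel(2)] I_uminus[OF rel(3)]
    by (simp_all add: acts_def L_closed nc_bracket_def algebra_simps)
  have central_u: "acts ?c ?u 0"
    using acts_diff[OF acts_uminus[OF central_v] central_w] by simp
  have central_br: "acts ?c \<lbrakk>f, g\<rbrakk> 0" if "acts ?c f 0" "acts ?c g 0" for f g
    using acts_bracket[OF that] by (simp add: nc_bracket_def)
  have replace_u: "\<lbrakk>u, f\<rbrakk> - \<lbrakk>?u, g\<rbrakk> \<in> I" if "f - g \<in> I" "acts ?c g 0" for f g
  proof -
    have "\<lbrakk>u, f - g\<rbrakk> + \<lbrakk>?c, g\<rbrakk> \<in> I"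
      using that uvw(1) by (simp add: acts_def I_closed)
    then show ?thesis by (simp add: nc_bracket_def algebra_simps)
  qed
  have keep_v: "\<lbrakk>v, f\<rbrakk> - \<lbrakk>v, g\<rbrakk> \<in> I" if "f - g \<in> I" for f g
    using lie_ideal.bracket[OF uvw(2) that] by (simp add: nc_bracket_linear)
  note central = central_br central_u central_v
  have 2: "\<lbrakk>u, v\<rbrakk> - \<lbrakk>?u, v\<rbrakk> \<in> I"
    by (rule replace_u) (simp_all add: central I_closed)
  have 3: "\<lbrakk>u, \<lbrakk>u, v\<rbrakk>\<rbrakk> - \<lbrakk>?u, \<lbrakk>?u, v\<rbrakk>\<rbrakk> \<in> I"
    by (rule replace_u[OF 2]) (intro central)
  have "2 * (\<lbrakk>u, \<lbrakk>u, \<lbrakk>u, v\<rbrakk>\<rbrakk>\<rbrakk> - \<lbrakk>?u, \<lbrakk>?u, \<lbrakk>?u, v\<rbrakk>\<rbrakk>\<rbrakk>) + 2 * (\<lbrakk>v, \<lbrakk>v, \<lbrakk>u, v\<rbrakk>\<rbrakk>\<rbrakk> - \<lbrakk>v, \<lbrakk>v, \<lbrakk>?u, v\<rbrakk>\<rbrakk>\<rbrakk>)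
      + 3 * (\<lbrakk>v, \<lbrakk>u, \<lbrakk>u, v\<rbrakk>\<rbrakk>\<rbrakk> - \<lbrakk>v, \<lbrakk>?u, \<lbrakk>?u, v\<rbrakk>\<rbrakk>\<rbrakk>) \<in> I"
    by (rule lie_ideal.add lie_ideal.add I_numeral replace_u keep_v 2 3 central)+
  then show ?thesis
    unfolding lie_quartic_psi_def right_diff_distrib by (simp only: add_diff_add)
qed

text \<open>
  Here \<open>a\<close> and \<open>c\<close> act on the Lie algebra generated by \<open>d, e, f\<close>: \<open>a\<close> acts on \<open>d, e\<close> as
  \<open>[\<cdot>, d + e]\<close> and kills \<open>f\<close>, while \<open>c\<close> acts on \<open>e, f\<close> as \<open>[\<cdot>, e + f]\<close> and kills \<open>d\<close>.
  The three Lie words of \<open>\<psi>\<close> are evaluated at \<open>(a, 0)\<close> and \<open>(c, e)\<close> in the semidirect product.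
  The difference on the left is the second component of the result, and the identity that this
  leaves in \<open>d, e, f\<close> is the only place where characteristic 5 enters.
\<close>

lemma quartic_psi_splits:
  assumes L: "a \<in> L" "c \<in> L" "d \<in> L" "e \<in> L" "f \<in> L"
    and ad: "\<lbrakk>a, d + e\<rbrakk> \<in> I" "\<lbrakk>d, a + e\<rbrakk> \<in> I" "\<lbrakk>a, f\<rbrakk> \<in> I"
    and cd: "\<lbrakk>c, e + f\<rbrakk> \<in> I" "\<lbrakk>f, c + e\<rbrakk> \<in> I" "\<lbrakk>c, d\<rbrakk> \<in> I"
    and char5: "CHAR('k) = 5"
  shows "lie_quartic_psi a (c + e) - lie_quartic_psi a c
    - (lie_quartic_A f e + lie_quartic_A (e + f) d - lie_quartic_A f (d + e)) \<in> I"
proof -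
  let ?p = "d + e" and ?q = "e + f"
  let ?D = "\<lbrakk>d, e\<rbrakk>" and ?E = "\<lbrakk>e, f\<rbrakk>" and ?F = "\<lbrakk>d, f\<rbrakk>"
  note in_L = L L_closed
  note lie_simps = nc_bracket_def algebra_simps
  have acts_cong: "acts X f g' \<Longrightarrow> g' = g \<Longrightarrow> acts X f g" for X f g g' by simp
  have splits_cong: "splits z X p' \<Longrightarrow> p' = p \<Longrightarrow> splits z X p" for z X p p' by simp
  have a_d: "acts a d \<lbrakk>d, ?p\<rbrakk>"
    using acts_of_bracket_in_I[OF L(1,3,4) ad(2)] by (simp add: lie_simps)
  have "acts a ?p 0"
    using ad(1) by (simp add: acts_def in_L)
  from acts_diff[OF this a_d] have a_e: "acts a e \<lbrakk>e, ?p\<rbrakk>"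
    by (simp add: lie_simps)
  have a_f: "acts a f 0"
    using ad(3) by (simp add: acts_def in_L)
  have c_f: "acts c f \<lbrakk>f, ?q\<rbrakk>"
    using acts_of_bracket_in_I[OF L(2,5,4) cd(2)] by (simp add: lie_simps)
  have "acts c ?q 0"
    using cd(1) by (simp add: acts_def in_L)
  from acts_diff[OF this c_f] have c_e: "acts c e \<lbrakk>e, ?q\<rbrakk>"
    by (simp add: lie_simps)
  have c_d: "acts c d 0"
    using cd(3) by (simp add: acts_def in_L)

  \<comment> \<open>The action of \<open>a\<close> and \<open>c\<close> on the Lie words that occur below.\<close>
  have a_D: "acts a ?D \<lbrakk>?D, ?p\<rbrakk>"
    by (rule acts_inner[OF a_d a_e])
  have a_Dp: "acts a \<lbrakk>?D, ?p\<rbrakk> \<lbrakk>\<lbrakk>?D, ?p\<rbrakk>, ?p\<rbrakk>"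
    by (rule acts_inner[OF a_D], rule acts_cong[OF acts_add[OF a_d a_e]]) (simp add: lie_simps)
  have a_F: "acts a ?F \<lbrakk>?D, f\<rbrakk>"
    by (rule acts_cong[OF acts_bracket[OF a_d a_f]]) (simp add: lie_simps)
  have a_E: "acts a ?E (- \<lbrakk>?D, f\<rbrakk>)"
    by (rule acts_cong[OF acts_bracket[OF a_e a_f]]) (simp add: lie_simps)
  have a_eF: "acts a \<lbrakk>e, ?F\<rbrakk> (\<lbrakk>e, \<lbrakk>?D, f\<rbrakk>\<rbrakk> - \<lbrakk>?D, ?F\<rbrakk>)"
    by (rule acts_cong[OF acts_bracket[OF a_e a_F]]) (simp add: lie_simps)
  have c_D: "acts c ?D \<lbrakk>d, ?E\<rbrakk>"
    by (rule acts_cong[OF acts_bracket[OF c_d c_e]]) (simp add: lie_simps)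
  have c_E: "acts c ?E \<lbrakk>?E, ?q\<rbrakk>"
    by (rule acts_inner[OF c_e c_f])
  have c_F: "acts c ?F (- \<lbrakk>d, ?E\<rbrakk>)"
    by (rule acts_cong[OF acts_bracket[OF c_d c_f]]) (simp add: lie_simps)
  have c_Dp: "acts c \<lbrakk>?D, ?p\<rbrakk> (\<lbrakk>\<lbrakk>d, ?E\<rbrakk>, ?p\<rbrakk> + \<lbrakk>?D, ?E\<rbrakk>)"
    by (rule acts_cong[OF acts_bracket[OF c_D acts_add[OF c_d c_e]]]) (simp add: lie_simps)
  have c_eF: "acts c \<lbrakk>e, ?F\<rbrakk> (\<lbrakk>?E, ?F\<rbrakk> - \<lbrakk>e, \<lbrakk>d, ?E\<rbrakk>\<rbrakk>)"
    by (rule acts_cong[OF acts_bracket[OF c_e c_F]]) (simp add: lie_simps)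

  \<comment> \<open>The action of the brackets \<open>[a, c]\<close>, \<open>[a, [a, c]]\<close>, \<open>[c, [a, c]]\<close>, needed because the second
      argument \<open>c + e\<close> of \<open>\<psi>\<close> has the component \<open>e\<close>.\<close>
  have ac_d: "acts \<lbrakk>a, c\<rbrakk> d (- \<lbrakk>d, ?E\<rbrakk>)"
    by (rule acts_cong[OF acts_commutator[OF a_d c_d acts_zero[OF L(1)] acts_bracket[OF c_d acts_add[OF c_d c_e]]]])
      (simp add: lie_simps)
  have ac_e: "acts \<lbrakk>a, c\<rbrakk> e \<lbrakk>e, ?F\<rbrakk>"
    by (rule acts_cong[OF acts_commutator[OF a_e c_e acts_bracket[OF a_e acts_add[OF a_e a_f]]
            acts_bracket[OF c_e acts_add[OF c_d c_e]]]])
      (simp add: lie_simps)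
  have ac_f: "acts \<lbrakk>a, c\<rbrakk> f \<lbrakk>?D, f\<rbrakk>"
    by (rule acts_cong[OF acts_commutator[OF a_f c_f acts_bracket[OF a_f acts_add[OF a_e a_f]]
            acts_zero[OF L(2)]]])
      (simp add: lie_simps)
  let ?w2 = "\<lbrakk>e, \<lbrakk>?D, f\<rbrakk>\<rbrakk> - \<lbrakk>?D, ?F\<rbrakk> - \<lbrakk>\<lbrakk>d, ?E\<rbrakk>, e\<rbrakk> + \<lbrakk>d, \<lbrakk>e, ?F\<rbrakk>\<rbrakk>"
  let ?w3 = "\<lbrakk>?E, ?F\<rbrakk> - \<lbrakk>e, \<lbrakk>d, ?E\<rbrakk>\<rbrakk> - \<lbrakk>\<lbrakk>e, ?F\<rbrakk>, f\<rbrakk> - \<lbrakk>e, \<lbrakk>?D, f\<rbrakk>\<rbrakk>"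
  have aac_e: "acts \<lbrakk>a, \<lbrakk>a, c\<rbrakk>\<rbrakk> e ?w2"
    by (rule acts_cong[OF acts_commutator[OF a_e ac_e a_eF acts_bracket[OF ac_e acts_add[OF ac_d ac_e]]]])
      (simp add: lie_simps)
  have cac_e: "acts \<lbrakk>c, \<lbrakk>a, c\<rbrakk>\<rbrakk> e ?w3"
    by (rule acts_cong[OF acts_commutator[OF c_e ac_e c_eF acts_bracket[OF ac_e acts_add[OF ac_e ac_f]]]])
      (simp add: lie_simps)

  let ?g = "- \<lbrakk>d, ?E\<rbrakk> - \<lbrakk>e, ?F\<rbrakk> - \<lbrakk>e, ?D\<rbrakk>"
  have c_g: "acts c ?g (- \<lbrakk>d, \<lbrakk>?E, ?q\<rbrakk>\<rbrakk> - \<lbrakk>?E, ?F\<rbrakk> - \<lbrakk>?E, ?D\<rbrakk>)"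
    by (rule acts_cong[OF acts_diff[OF acts_diff[OF acts_uminus[OF acts_bracket[OF c_d c_E]] c_eF]
            acts_bracket[OF c_e c_D]]])
      (simp add: lie_simps)

  have ac: "\<lbrakk>a, c\<rbrakk> \<in> L"
    by (intro in_L)
  have x: "splits a a 0" and y: "splits (c + e) c e"
    by (simp_all add: splits_def in_L I_closed)
  have xy: "splits \<lbrakk>a, c + e\<rbrakk> \<lbrakk>a, c\<rbrakk> (- ?D)"
    by (rule splits_cong[OF splits_bracket[OF x y a_e acts_zero[OF L(2)]]]) (simp add: lie_simps)
  have xxy: "splits \<lbrakk>a, \<lbrakk>a, c + e\<rbrakk>\<rbrakk> \<lbrakk>a, \<lbrakk>a, c\<rbrakk>\<rbrakk> (- \<lbrakk>?D, ?p\<rbrakk>)"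
    by (rule splits_cong[OF splits_bracket[OF x xy acts_uminus[OF a_D] acts_zero[OF ac]]])
      (simp add: nc_bracket_def)
  have xxxy: "splits \<lbrakk>a, \<lbrakk>a, \<lbrakk>a, c + e\<rbrakk>\<rbrakk>\<rbrakk> \<lbrakk>a, \<lbrakk>a, \<lbrakk>a, c\<rbrakk>\<rbrakk>\<rbrakk> (- \<lbrakk>\<lbrakk>?D, ?p\<rbrakk>, ?p\<rbrakk>)"
    by (rule splits_cong[OF splits_bracket[OF x xxy acts_uminus[OF a_Dp]
            acts_zero[OF lie_generated.bracket[OF L(1) ac]]]])
      (simp add: nc_bracket_def)
  note yxxy = splits_bracket[OF y xxy acts_uminus[OF c_Dp] aac_e]
  have yxy: "splits \<lbrakk>c + e, \<lbrakk>a, c + e\<rbrakk>\<rbrakk> \<lbrakk>c, \<lbrakk>a, c\<rbrakk>\<rbrakk> ?g"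
    by (rule splits_cong[OF splits_bracket[OF y xy acts_uminus[OF c_D] ac_e]])
      (simp add: nc_bracket_linear)
  note yyxy = splits_bracket[OF y yxy c_g cac_e]

  have psi_in: "2 * (z1 - (X1 + r1)) + 2 * (z2 - (X2 + r2)) + 3 * (z3 - (X3 + r3)) \<in> I"
    if "splits z1 X1 r1" "splits z2 X2 r2" "splits z3 X3 r3" for z1 z2 z3 X1 X2 X3 r1 r2 r3
    using that by (simp only: splits_def I_closed)
  note in_I = psi_in[OF xxxy yyxy yxxy]
  let ?Q = "2 * (- \<lbrakk>\<lbrakk>?D, ?p\<rbrakk>, ?p\<rbrakk>)
      + 2 * (- \<lbrakk>d, \<lbrakk>?E, ?q\<rbrakk>\<rbrakk> - \<lbrakk>?E, ?F\<rbrakk> - \<lbrakk>?E, ?D\<rbrakk> - ?w3 + \<lbrakk>e, ?g\<rbrakk>)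
      + 3 * (- (\<lbrakk>\<lbrakk>d, ?E\<rbrakk>, ?p\<rbrakk> + \<lbrakk>?D, ?E\<rbrakk>) - ?w2 + \<lbrakk>e, - \<lbrakk>?D, ?p\<rbrakk>\<rbrakk>)"
  have "?Q = lie_quartic_A f e + lie_quartic_A (e + f) d - lie_quartic_A f (d + e)"
  proof -
    have "hvanish 5 (let p = hX + hY; q = hY + hZ; D = hbr hX hY; E = hbr hY hZ; F = hbr hX hZ;
        w2 = hbr hY (hbr D hZ) - hbr D F - hbr (hbr hX E) hY + hbr hX (hbr hY F);
        w3 = hbr E F - hbr hY (hbr hX E) - hbr (hbr hY F) hZ - hbr hY (hbr D hZ);
        g = hscale (-1) (hbr hX E) - hbr hY F - hbr hY D
      in hscale 2 (hscale (-1) (hbr (hbr D p) p))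
       + hscale 2 (hscale (-1) (hbr hX (hbr E q)) - hbr E F - hbr E D - w3 + hbr hY g)
       + hscale 3 (hscale (-1) (hbr (hbr hX E) p + hbr D E) - w2 + hbr hY (hscale (-1) (hbr D p)))
       - (hA hZ hY + hA q hX - hA hZ p))"
      by code_simp
    from hvanish_imp_hval_eq_0[OF this five_eq_0[OF char5], of d e f] show ?thesis
      unfolding Let_def hval_ops hval_quartic by simp
  qed
  moreover have "lie_quartic_psi a (c + e) - lie_quartic_psi a c - ?Q \<in> I"
    using in_I unfolding lie_quartic_psi_def by (simp add: algebra_simps)
  ultimately show ?thesis by (simp only:)
qed

end


section \<open>The pentagon equation\<close>

interpretation t4: lie_presentation
  "{tgen i j | i j. i \<in> {1..4} \<and> j \<in> {1..4} \<and> i \<noteq> j} :: (nat set, 'k::field) ncs set"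
  "t_relators 4" .

lemma t_free_4: "t_free 4 = t4.L"
  by (simp add: t_free_def)

lemma tgen_commute: "tgen i j = tgen j i"
  by (simp add: tgen_def insert_commute)

lemma tgen_in_t4:
  assumes "i \<in> {1..4}" "j \<in> {1..4}" "i \<noteq> j"
  shows "tgen i j \<in> t4.L"
  using assms by (auto intro!: lie_generated.gen)

lemma t4_disjoint:
  assumes "{i, j, k, l} \<subseteq> {1..4}" "distinct [i, j, k, l]"
  shows "\<lbrakk>tgen i j, tgen k l\<rbrakk> \<in> t4.I"
  by (rule lie_ideal.gen, unfold t_relators_def, rule UnI1) (use assms in blast)

text \<open>
  With \<open>i j\<close> as the pair of the single generator this orients the triangle relation as
  \<open>quartic_psi_shift\<close> and \<open>quartic_psi_splits\<close> use it.
\<close>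

lemma t4_triangle:
  assumes "{i, j, k} \<subseteq> {1..4}" "distinct [i, j, k]"
  shows "\<lbrakk>tgen i j, tgen i k + tgen j k\<rbrakk> \<in> t4.I"
proof -
  have "\<lbrakk>tgen k i + tgen k j, tgen i j\<rbrakk> \<in> t4.I"
    by (rule lie_ideal.gen, unfold t_relators_def, rule UnI2) (use assms in fastforce)
  from t4.I_uminus[OF this] show ?thesis
    by (simp add: nc_bracket_def tgen_commute[of k])
qed

text \<open>
  The triples fed to \<open>quartic_psi_shift\<close> are the images of the generators of \<open>t_3\<close> under relabelling
  and doubling strands: \<open>(t^{2,3}, t^{3,4}, t^{2,4})\<close>, \<open>(t^{12,3}, t^{3,4}, t^{12,4})\<close> and
  \<open>(t^{1,23}, t^{23,4}, t^{1,4})\<close>.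
\<close>

lemma pentagon_quartic_psi:
  assumes char5: "CHAR('k::field) = 5"
  shows "pentagon (lie_quartic_psi gen_x gen_y :: (letter, 'k) ncs)"
proof -
  define a b c d e f :: "(nat set, 'k) ncs"
    where "a = tgen 1 2" and "b = tgen 1 3" and "c = tgen 2 3"
      and "d = tgen 1 4" and "e = tgen 2 4" and "f = tgen 3 4"
  note t_defs = a_def b_def c_def d_def e_def f_def
  have L: "a \<in> t4.L" "b \<in> t4.L" "c \<in> t4.L" "d \<in> t4.L" "e \<in> t4.L" "f \<in> t4.L"
    unfolding t_defs by (intro tgen_in_t4; simp)+
  have disjoint: "\<lbrakk>a, f\<rbrakk> \<in> t4.I" "\<lbrakk>f, a\<rbrakk> \<in> t4.I" "\<lbrakk>b, e\<rbrakk> \<in> t4.I" "\<lbrakk>e, b\<rbrakk> \<in> t4.I"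
      "\<lbrakk>c, d\<rbrakk> \<in> t4.I" "\<lbrakk>d, c\<rbrakk> \<in> t4.I"
    unfolding t_defs by (rule t4_disjoint; simp)+
  have triangle: "\<lbrakk>a, d + e\<rbrakk> \<in> t4.I" "\<lbrakk>d, a + e\<rbrakk> \<in> t4.I" "\<lbrakk>e, a + d\<rbrakk> \<in> t4.I"
      "\<lbrakk>b, d + f\<rbrakk> \<in> t4.I" "\<lbrakk>d, b + f\<rbrakk> \<in> t4.I" "\<lbrakk>f, b + d\<rbrakk> \<in> t4.I"
      "\<lbrakk>c, e + f\<rbrakk> \<in> t4.I" "\<lbrakk>e, c + f\<rbrakk> \<in> t4.I" "\<lbrakk>f, c + e\<rbrakk> \<in> t4.I"
    using t4_triangle[of 1 2 4] t4_triangle[of 1 4 2] t4_triangle[of 2 4 1]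
      t4_triangle[of 1 3 4] t4_triangle[of 1 4 3] t4_triangle[of 3 4 1]
      t4_triangle[of 2 3 4] t4_triangle[of 2 4 3] t4_triangle[of 3 4 2]
    unfolding t_defs
    by (simp_all add: tgen_commute[of 2 1] tgen_commute[of 3 1] tgen_commute[of 4 1]
        tgen_commute[of 3 2] tgen_commute[of 4 2] tgen_commute[of 4 3] del: One_nat_def)

  have "lie_quartic_psi c f - lie_quartic_psi (- f - e) f \<in> t4.I"
    by (rule t4.quartic_psi_shift)
      (use L triangle in \<open>simp_all add: t4.L_closed add.commute\<close>)
  then have 1: "lie_quartic_psi c f - lie_quartic_A f e \<in> t4.I"
    by (simp only: psi_cyclic[OF char5])
  have "lie_quartic_psi (b + c) f - lie_quartic_psi (- f - (d + e)) f \<in> t4.I"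
  proof (rule t4.quartic_psi_shift)
    have "\<lbrakk>b, d + f\<rbrakk> + \<lbrakk>c, e + f\<rbrakk> + \<lbrakk>b, e\<rbrakk> + \<lbrakk>c, d\<rbrakk> \<in> t4.I"
      by (intro lie_ideal.add triangle disjoint)
    then show "\<lbrakk>b + c, f + (d + e)\<rbrakk> \<in> t4.I" by (simp add: nc_bracket_def algebra_simps)
    have "\<lbrakk>f, b + d\<rbrakk> + \<lbrakk>f, c + e\<rbrakk> \<in> t4.I"
      by (intro lie_ideal.add triangle disjoint)
    then show "\<lbrakk>f, d + e + (b + c)\<rbrakk> \<in> t4.I" by (simp add: nc_bracket_def algebra_simps)
    have "\<lbrakk>d, b + f\<rbrakk> + \<lbrakk>e, c + f\<rbrakk> + \<lbrakk>e, b\<rbrakk> + \<lbrakk>d, c\<rbrakk> \<in> t4.I"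
      by (intro lie_ideal.add triangle disjoint)
    then show "\<lbrakk>d + e, b + c + f\<rbrakk> \<in> t4.I" by (simp add: nc_bracket_def algebra_simps)
  qed (intro L lie_generated.add)+
  then have 2: "lie_quartic_psi (b + c) f - lie_quartic_A f (d + e) \<in> t4.I"
    by (simp only: psi_cyclic[OF char5])
  have "lie_quartic_psi (a + b) (e + f) - lie_quartic_psi (- (e + f) - d) (e + f) \<in> t4.I"
  proof (rule t4.quartic_psi_shift)
    have "\<lbrakk>a, d + e\<rbrakk> + \<lbrakk>b, d + f\<rbrakk> + \<lbrakk>a, f\<rbrakk> + \<lbrakk>b, e\<rbrakk> \<in> t4.I"
      by (intro lie_ideal.add triangle disjoint)
    then show "\<lbrakk>a + b, e + f + d\<rbrakk> \<in> t4.I" by (simp add: nc_bracket_def algebra_simps)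
    have "\<lbrakk>e, a + d\<rbrakk> + \<lbrakk>f, b + d\<rbrakk> + \<lbrakk>e, b\<rbrakk> + \<lbrakk>f, a\<rbrakk> \<in> t4.I"
      by (intro lie_ideal.add triangle disjoint)
    then show "\<lbrakk>e + f, d + (a + b)\<rbrakk> \<in> t4.I" by (simp add: nc_bracket_def algebra_simps)
    have "\<lbrakk>d, a + e\<rbrakk> + \<lbrakk>d, b + f\<rbrakk> \<in> t4.I"
      by (intro lie_ideal.add triangle disjoint)
    then show "\<lbrakk>d, a + b + (e + f)\<rbrakk> \<in> t4.I" by (simp add: nc_bracket_def algebra_simps)
  qed (intro L lie_generated.add)+
  then have 3: "lie_quartic_psi (a + b) (e + f) - lie_quartic_A (e + f) d \<in> t4.I"
    by (simp only: psi_cyclic[OF char5])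
  have 4: "lie_quartic_psi a (c + e) - lie_quartic_psi a c
      - (lie_quartic_A f e + lie_quartic_A (e + f) d - lie_quartic_A f (d + e)) \<in> t4.I"
    by (rule t4.quartic_psi_splits) (fact L triangle disjoint char5)+

  let ?P = "(lie_quartic_psi a (c + e) + lie_quartic_psi (b + c) f)
    - (lie_quartic_psi c f + lie_quartic_psi (a + b) (e + f) + lie_quartic_psi a c)"
  have "?P \<in> t4.I"
    using lie_ideal.add[OF 4 t4.I_diff[OF t4.I_diff[OF 2 1] 3]] by (simp add: algebra_simps)
  moreover have "homogeneous 4 ?P"
    unfolding t_defs tgen_def
    by (intro homogeneous_diff homogeneous_add homogeneous_quartic homogeneous_gen)
  ultimately have "?P \<in> nc_completion (lie_ideal (t_free 4) (t_relators 4))"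
    unfolding t_free_4 by (intro homogeneous_in_completion lie_ideal.zero)
  moreover have coeff_Nil: "nc_coeff (tgen i j) [] = (0 :: 'k)" for i j
    by (simp add: tgen_def)
  ultimately show ?thesis
    unfolding pentagon_def t_class_def
      nc_coset_eq_iff[OF subspace_nc_completion[OF subspace_lie_ideal]]
    by (simp add: nc_subst_quartic_psi t_defs)
qed


section \<open>The elements over a field of characteristic 5\<close>

theorem mainTheorem3:
  fixes x y A B \<psi> :: "(letter, 'k::field) ncs"
  assumes "CHAR('k) = 5"
    and "x = gen_x" and "y = gen_y"
    and "A = \<lbrakk>x, \<lbrakk>x, \<lbrakk>x, y\<rbrakk>\<rbrakk>\<rbrakk> + \<lbrakk>y, \<lbrakk>x, \<lbrakk>x, y\<rbrakk>\<rbrakk>\<rbrakk> + 2 * \<lbrakk>y, \<lbrakk>y, \<lbrakk>x, y\<rbrakk>\<rbrakk>\<rbrakk>"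
    and "B = \<lbrakk>y, \<lbrakk>y, \<lbrakk>y, x\<rbrakk>\<rbrakk>\<rbrakk> + \<lbrakk>x, \<lbrakk>y, \<lbrakk>y, x\<rbrakk>\<rbrakk>\<rbrakk> + 2 * \<lbrakk>x, \<lbrakk>x, \<lbrakk>y, x\<rbrakk>\<rbrakk>\<rbrakk>"
    and "\<psi> = 2 * \<lbrakk>x, \<lbrakk>x, \<lbrakk>x, y\<rbrakk>\<rbrakk>\<rbrakk> + 2 * \<lbrakk>y, \<lbrakk>y, \<lbrakk>x, y\<rbrakk>\<rbrakk>\<rbrakk> + 3 * \<lbrakk>y, \<lbrakk>x, \<lbrakk>x, y\<rbrakk>\<rbrakk>\<rbrakk>"
  shows "A \<in> lie2 \<and> B \<in> lie2
    \<and> \<lbrakk>x, A\<rbrakk> + \<lbrakk>y, B\<rbrakk> = (x + y) ^ 5 - x ^ 5 - y ^ 5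
    \<and> nc_tr (x * partial_x A + y * partial_y B)
        = tr_scale (1 / 2) (nc_tr ((x + y) ^ 4 - x ^ 4 - y ^ 4))
    \<and> nc_subst (- x - y) x \<psi> = A
    \<and> nc_subst (- x - y) y \<psi> = B
    \<and> \<psi> \<in> grt"
proof -
  note char5 = assms(1)
  have A: "A = lie_quartic_A x y" and B: "B = lie_quartic_A y x" and psi: "\<psi> = lie_quartic_psi x y"
    by (simp_all only: assms(4-6) lie_quartic_A_def lie_quartic_psi_def)
  have subst: "nc_subst u v \<psi> = lie_quartic_psi u v"
    if "nc_coeff u [] = 0" "nc_coeff v [] = 0" for u v :: "(letter, 'k) ncs"
    unfolding psi assms(2,3) by (rule nc_subst_quartic_psi[OF that])
  have "A \<in> lie2" "B \<in> lie2" "\<psi> \<in> lie2"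
    unfolding A B psi assms(2,3) by (rule quartic_in_lie2; simp)+
  moreover have "nc_subst (- x - y) x \<psi> = A" "nc_subst (- x - y) y \<psi> = B"
    by (simp_all add: subst assms(2,3) A B psi_cyclic[OF char5])
  moreover have "\<psi> \<in> grt"
    unfolding grt_def mem_Collect_eq
  proof (intro conjI)
    show "\<psi> \<in> lie2" by fact
    show "nc_subst gen_x gen_y \<psi> = - nc_subst gen_y gen_x \<psi>"
      using psi_antisymmetric[OF char5, of gen_x gen_y] by (simp add: subst)
    show "nc_subst gen_x gen_y \<psi> + nc_subst gen_y (- gen_x - gen_y) \<psi>
        + nc_subst (- gen_x - gen_y) gen_x \<psi> = 0"
      using psi_hexagon[OF char5, of gen_x gen_y] by (simp add: subst)
    show "pentagon \<psi>"
      unfolding psi assms(2,3) by (rule pentagon_quartic_psi[OF char5])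
  qed
  moreover have "\<lbrakk>x, A\<rbrakk> + \<lbrakk>y, B\<rbrakk> = (x + y) ^ 5 - x ^ 5 - y ^ 5"
    unfolding A B by (rule commutator_identity[OF char5])
  moreover have "nc_tr (x * partial_x A + y * partial_y B)
      = tr_scale (1 / 2) (nc_tr ((x + y) ^ 4 - x ^ 4 - y ^ 4))"
    unfolding A B by (rule trace_identity[OF char5 assms(2,3)])
  ultimately show ?thesis by blast
qed

end
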